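(* Let $m\ge1$ and $\xi=\exp(2\pi\sqrt{-1}/m)$. For all colored partitions $\overline\lambda=\lambda_0|\dots|\lambda_{m-1}$ (i.e. $m$-tuples of partitions), the polynomials $$s_{\overline\lambda}(\mathbf P^{(0)},\dots,\mathbf P^{(m-1)})=s_{\lambda_0}(\mathbf P^{(0)})\cdots s_{\lambda_{m-1}}(\mathbf P^{(m-1)}),$$ where $\mathbf P^{(\alpha)}=\left(\frac{\sum_{\beta}\xi^{\alpha\beta}p^{(\beta)}_1}{m},\ \frac{\sum_{\beta}\xi^{\alpha\beta}p^{(\beta)}_2}{m},\ \dots\right)$ (sums over $\beta=0,\dots,m-1$), are eigenvectors of $\mathcal{CJ}_0$ and of $\mathcal{CJ}_k$ for all $k=1,\dots,m-1$. The respective eigenvalues are $$c_0(\overline\lambda)=m\sum_{i=1}^\infty\bigl(\lambda_{0,i}(\lambda_{0,i}-2i+1)+\lambda_{1,i}(\lambda_{1,i}-2i+1)+\dots+\lambda_{m-1,i}(\lambda_{m-1,i}-2i+1)\bigr)$$ for $\mathcal{CJ}_0$ and $$c_k(\overline\lambda)=\sum_{i=1}^\infty\left(\lambda_{0,i}+\xi^k\lambda_{1,i}+\dots+\xi^{k(m-1)}\lambda_{m-1,i}\right)$$ for $\mathcal{CJ}_k$.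
   Context: Partitions are written $\lambda_\alpha=(\lambda_{\alpha,1}\ge\lambda_{\alpha,2}\ge\dots)$ with $\lambda_{\alpha,i}=0$ for large $i$. For a partition $\lambda$, $s_\lambda(q_1,q_2,\dots)$ is the Schur polynomial expressed as a polynomial in the power sums $q_1,q_2,\dots$ (e.g. $s_{(2)}=\frac12(q_1^2+q_2)$). The cut-and-join operators of the reflection groups $G(m,1,n)$ act on polynomials in the variables $p^{(\alpha)}_i$ ($\alpha\in\mathbb{Z}/m\mathbb{Z}$, $i\ge1$) by $$\mathcal{CJ}_0=\frac12\sum_{\substack{i,j\ge 1\\ \alpha,\gamma\in\mathbb{Z}/m\mathbb{Z}}}\left((i+j)\,p^{(\alpha)}_i p^{(\gamma)}_j\frac{\partial}{\partial p^{(\alpha+\gamma)}_{i+j}}+m\,ij\,p^{(\alpha+\gamma)}_{i+j}\frac{\partial^2}{\partial p^{(\alpha)}_i\,\partial p^{(\gamma)}_j}\right),$$ $$\mathcal{CJ}_k=\sum_{i\ge 1,\ \alpha\in\mathbb{Z}/m\mathbb{Z}} i\,p^{(\alpha+k)}_i\frac{\partial}{\partial p^{(\alpha)}_i}\qquad (k=1,\dots,m-1),$$ with upper indices modulo $m$.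
   Formalization: The printed eigenvalues are wrong for the stated operators and are corrected: c_0 has prefactor m/2 instead of m (m=1, λ=(2) gives 1, not 2), and c_k has ξ^{-kα} instead of ξ^{kα} as coefficient of λ_{α,i} (m=3, k=1, λ_1=(1) gives ξ^{-1}). *)

theory Defs
  imports Complex_Main "HOL-Library.Poly_Mapping" "Jordan_Normal_Form.Determinant"
begin

section \<open>Polynomials in indeterminates indexed by a type\<close>

text \<open>A polynomial maps monomials to coefficients; a monomial maps indeterminates to exponents.
  Addition and multiplication are those of \<^theory>\<open>HOL-Library.Poly_Mapping\<close>.\<close>

type_synonym 'v cpoly = "('v \<Rightarrow>\<^sub>0 nat) \<Rightarrow>\<^sub>0 complex"

definition Const :: "complex \<Rightarrow> 'v cpoly" where
  "Const c = Poly_Mapping.single 0 c"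

definition Var :: "'v \<Rightarrow> 'v cpoly" where
  "Var v = Poly_Mapping.single (Poly_Mapping.single v 1) 1"

definition poly_vars :: "'v cpoly \<Rightarrow> 'v set" where
  "poly_vars f = (\<Union>t \<in> Poly_Mapping.keys f. Poly_Mapping.keys t)"

definition poly_subst :: "('v \<Rightarrow> 'w cpoly) \<Rightarrow> 'v cpoly \<Rightarrow> 'w cpoly" where
  "poly_subst g f = (\<Sum>t \<in> Poly_Mapping.keys f.
     Const (Poly_Mapping.lookup f t) * (\<Prod>v \<in> Poly_Mapping.keys t. g v ^ Poly_Mapping.lookup t v))"

text \<open>Subtraction of monomials truncates, but a monomial not containing \<open>v\<close> has factor 0.\<close>

definition pderiv_var :: "'v \<Rightarrow> 'v cpoly \<Rightarrow> 'v cpoly" where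
  "pderiv_var v f = (\<Sum>t \<in> Poly_Mapping.keys f.
     Poly_Mapping.single (t - Poly_Mapping.single v 1)
       (of_nat (Poly_Mapping.lookup t v) * Poly_Mapping.lookup f t))"

section \<open>Partitions and Schur polynomials\<close>

text \<open>The parts are \<open>lam 1 \<ge> lam 2 \<ge> \<dots>\<close>; the value \<open>lam 0\<close> is never used.\<close>

definition is_partition :: "(nat \<Rightarrow> nat) \<Rightarrow> bool" where
  "is_partition lam \<longleftrightarrow> (\<forall>i\<ge>1. lam (Suc i) \<le> lam i) \<and> (\<exists>n. \<forall>i>n. lam i = 0)"

text \<open>The Schur polynomial \<open>s_lam(x_1, \<dots>, x_N)\<close> as quotient of the alternants
  \<open>det (x_i ^ (lam_j + N - j))\<close> and \<open>det (x_i ^ (N - j))\<close>. Matrix indices start at 0, so column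
  \<open>j\<close> below is column \<open>j + 1\<close> of the formula, and \<open>Var i\<close> is \<open>x_(i+1)\<close>.\<close>

definition alternant :: "nat \<Rightarrow> (nat \<Rightarrow> nat) \<Rightarrow> nat cpoly" where
  "alternant N lam = det (mat N N (\<lambda>(i, j). Var i ^ (lam (Suc j) + (N - Suc j))))"

definition schur_x :: "nat \<Rightarrow> (nat \<Rightarrow> nat) \<Rightarrow> nat cpoly" where
  "schur_x N lam = (THE s. s * alternant N (\<lambda>_. 0) = alternant N lam)"

definition power_sum :: "nat \<Rightarrow> nat \<Rightarrow> nat cpoly" where
  "power_sum N k = (\<Sum>i<N. Var i ^ k)"

text \<open>The polynomial \<open>s_lam(q_1, q_2, \<dots>)\<close>, with \<open>Var k\<close> for \<open>q_k\<close>: the unique polynomial which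
  becomes \<open>s_lam(x_1, \<dots>, x_N)\<close> on replacing every \<open>q_k\<close> by \<open>x_1^k + \<dots> + x_N^k\<close>, whatever the
  number \<open>N\<close> of variables (not smaller than the number of parts). It exists because Schur
  polynomials are symmetric and compatible with adding a variable, and is unique because
  the first \<open>N\<close> power sums in \<open>N\<close> variables are algebraically independent.\<close>

definition schur :: "(nat \<Rightarrow> nat) \<Rightarrow> nat cpoly" where
  "schur lam = (THE S. poly_vars S \<subseteq> {1..} \<and>
     (\<forall>N. (\<forall>i>N. lam i = 0) \<longrightarrow> poly_subst (power_sum N) S = schur_x N lam))"

section \<open>Cut-and-join operators\<close>

text \<open>The indeterminate \<open>p_i^(\<alpha>)\<close> is \<open>pv \<alpha> i\<close>, with residue \<open>\<alpha> < m\<close> and \<open>i \<ge> 1\<close>.\<close>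

abbreviation pv :: "nat \<Rightarrow> nat \<Rightarrow> (nat \<times> nat) cpoly" where
  "pv \<alpha> i \<equiv> Var (\<alpha>, i)"

abbreviation pd :: "nat \<Rightarrow> nat \<Rightarrow> (nat \<times> nat) cpoly \<Rightarrow> (nat \<times> nat) cpoly" where
  "pd \<alpha> i \<equiv> pderiv_var (\<alpha>, i)"

definition colored_polys :: "nat \<Rightarrow> (nat \<times> nat) cpoly set" where
  "colored_polys m = {f. poly_vars f \<subseteq> {..<m} \<times> {1..}}"

text \<open>\<^const>\<open>Sum_any\<close> is the sum of a finitely supported family. For a fixed
  polynomial \<open>f\<close> only finitely many of the summands are nonzero.\<close>

definition CJ0 :: "nat \<Rightarrow> (nat \<times> nat) cpoly \<Rightarrow> (nat \<times> nat) cpoly" where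
  "CJ0 m f = Const (1/2) * Sum_any (\<lambda>(i, j). if 1 \<le> i \<and> 1 \<le> j then
     (\<Sum>\<alpha><m. \<Sum>\<gamma><m.
        of_nat (i + j) * pv \<alpha> i * pv \<gamma> j * pd ((\<alpha> + \<gamma>) mod m) (i + j) f
      + of_nat (m * i * j) * pv ((\<alpha> + \<gamma>) mod m) (i + j) * pd \<alpha> i (pd \<gamma> j f)) else 0)"

definition CJ :: "nat \<Rightarrow> nat \<Rightarrow> (nat \<times> nat) cpoly \<Rightarrow> (nat \<times> nat) cpoly" where
  "CJ m k f = Sum_any (\<lambda>i. if 1 \<le> i then
     (\<Sum>\<alpha><m. of_nat i * pv ((\<alpha> + k) mod m) i * pd \<alpha> i f) else 0)"

definition is_eigenvector ::
  "nat \<Rightarrow> ((nat \<times> nat) cpoly \<Rightarrow> (nat \<times> nat) cpoly) \<Rightarrow> (nat \<times> nat) cpoly \<Rightarrow> complex \<Rightarrow> bool" where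
  "is_eigenvector m T f c \<longleftrightarrow> f \<in> colored_polys m \<and> f \<noteq> 0 \<and> T f = Const c * f"

section \<open>Colored Schur polynomials and their eigenvalues\<close>

definition \<xi> :: "nat \<Rightarrow> complex" where
  "\<xi> m = exp (2 * of_real pi * \<i> / of_nat m)"

definition colored_var :: "nat \<Rightarrow> nat \<Rightarrow> nat \<Rightarrow> (nat \<times> nat) cpoly" where
  "colored_var m \<alpha> i = (\<Sum>\<beta><m. Const (\<xi> m ^ (\<alpha> * \<beta>) / of_nat m) * pv \<beta> i)"

definition colored_schur :: "nat \<Rightarrow> (nat \<Rightarrow> nat \<Rightarrow> nat) \<Rightarrow> (nat \<times> nat) cpoly" where
  "colored_schur m lam = (\<Prod>\<alpha><m. poly_subst (colored_var m \<alpha>) (schur (lam \<alpha>)))"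

text \<open>The source prints the eigenvalues with prefactor \<open>m\<close> instead of \<open>m / 2\<close> in \<open>eigval0\<close>, and with
  \<open>\<xi>^(k \<alpha>)\<close> instead of \<open>\<xi>^(- k \<alpha>)\<close> in \<open>eigval\<close>. For the operators and polynomials above both are
  misprints. Case \<open>m = 1\<close>: \<open>(p_1^2 + p_2) / 2 = s_(2)\<close> has eigenvalue 1 under \<open>CJ0\<close>, while the
  printed value is 2. Case \<open>m = 3\<close>: for the tuple whose only nonempty partition is
  \<open>lam 1 = (1)\<close>, the polynomial \<open>(p_1^(0) + \<xi> p_1^(1) + \<xi>^2 p_1^(2)) / 3\<close> has eigenvalue \<open>\<xi>^(-1)\<close>
  under \<open>CJ 3 1\<close>, while the printed value is \<open>\<xi>\<close>.\<close>

definition eigval0 :: "nat \<Rightarrow> (nat \<Rightarrow> nat \<Rightarrow> nat) \<Rightarrow> complex" where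
  "eigval0 m lam = of_nat m / 2 * Sum_any (\<lambda>i. if 1 \<le> i then
     (\<Sum>\<alpha><m. of_nat (lam \<alpha> i) * (of_nat (lam \<alpha> i) - 2 * of_nat i + 1)) else 0)"

definition eigval :: "nat \<Rightarrow> nat \<Rightarrow> (nat \<Rightarrow> nat \<Rightarrow> nat) \<Rightarrow> complex" where
  "eigval m k lam = Sum_any (\<lambda>i. if 1 \<le> i then
     (\<Sum>\<alpha><m. inverse (\<xi> m) ^ (k * \<alpha>) * of_nat (lam \<alpha> i)) else 0)"

end

theory Submission
  imports Defs "HOL-Computational_Algebra.Formal_Power_Series" "HOL-Library.Nat_Bijection"
begin

text \<open>The roots of unity diagonalise the colours. In the new indeterminates
  \<open>P\<^sup>a\<^sub>i = (\<Sum>\<beta>. \<xi>\<^sup>a\<^sup>\<beta> p\<^sup>\<beta>\<^sub>i) / m\<close> orthogonality of characters turns the coloured cut-and-join operator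
  into \<open>m\<close> times a sum of \<open>m\<close> ordinary cut-and-join operators, one in each alphabet \<open>P\<^sup>a\<close>, and turns the
  colour shift by \<open>k\<close> into a sum of Euler operators with weights \<open>\<xi>\<^sup>-\<^sup>k\<^sup>a\<close> (\<open>CJ0_uncolor\<close>,
  \<open>CJ_uncolor\<close>). Operators in one alphabet act on a single factor of the product of Schur polynomials, so
  everything reduces to one partition \<open>\<lambda>\<close> and the operators \<open>cut_join\<close> and \<open>euler\<close>.

  For one partition, substitute power sums of \<open>N\<close> variables \<open>x\<^sub>i\<close>, and let \<open>\<theta>\<^sub>i = x\<^sub>i \<partial>/\<partial>x\<^sub>i\<close>.
  Every monomial of the alternant \<open>a\<^sub>\<lambda>\<close> has the exponents \<open>\<lambda>\<^sub>j + N - j\<close> in some order, so \<open>a\<^sub>\<lambda>\<close> is an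
  eigenvector of \<open>\<Sum>\<theta>\<^sub>i\<close> and of \<open>\<Sum>\<theta>\<^sub>i\<^sup>2\<close> (\<open>theta_power_alternant\<close>). On the other hand
  \<open>a\<^sub>\<lambda> = a\<^sub>0 s\<^sub>\<lambda>\<close> with the Vandermonde determinant \<open>a\<^sub>0\<close>, and the chain rule shows that conjugating
  \<open>\<Sum>\<theta>\<^sub>i\<^sup>2\<close> by \<open>a\<^sub>0\<close> gives \<open>cut_join\<close> plus a multiple of the Euler operator plus a constant
  (\<open>sum_theta_theta_vandermonde_mult\<close>). Comparing the two yields the eigenvalue
  \<open>\<Sum>\<lambda>\<^sub>i (\<lambda>\<^sub>i - 2 i + 1)\<close>, first after substitution and then, because power sums are algebraically
  independent, for \<open>s\<^sub>\<lambda>\<close> as a polynomial in the \<open>q\<^sub>k\<close>.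

  Schur polynomials are given by definite descriptions, so their existence and uniqueness belong to the
  proof. Existence: the Jacobi--Trudi determinant, whose entries are polynomials in the power
  sums by Newton's recursion, is the same for all \<open>N\<close> not smaller than the number of parts and satisfies \<open>a\<^sub>\<lambda> = a\<^sub>0 s\<^sub>\<lambda>\<close>
  (\<open>jacobi_trudi\<close>, \<open>jacobi_trudi_det_stable\<close>). Uniqueness is
  \<open>power_sums_algebraically_independent\<close>.\<close>

section \<open>Monomials, constants and induction on polynomials\<close>

lemma poly_mapping_sum_single:
  fixes f :: "'a \<Rightarrow>\<^sub>0 'b::comm_monoid_add"
  assumes "finite A" "Poly_Mapping.keys f \<subseteq> A"
  shows "f = (\<Sum>t\<in>A. Poly_Mapping.single t (Poly_Mapping.lookup f t))"
proof (rule poly_mapping_eqI)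
  fix k
  show "Poly_Mapping.lookup f k = Poly_Mapping.lookup (\<Sum>t\<in>A. Poly_Mapping.single t (Poly_Mapping.lookup f t)) k"
    using assms by (auto simp: lookup_sum lookup_single when_def sum.delta in_keys_iff)
qed

lemma Const_0 [simp]: "Const 0 = 0" and Const_1 [simp]: "Const 1 = 1"
  and Const_add: "Const (a + b) = Const a + Const b"
  and Const_mult: "Const (a * b) = Const a * Const b"
  and Const_uminus: "Const (- a) = - Const a"
  and Const_diff: "Const (a - b) = Const a - Const b"
  by (simp_all add: Const_def single_add mult_single single_uminus single_diff)

lemma Const_of_nat: "Const (of_nat n) = of_nat n"
  by (simp add: Const_def)

lemma Const_sum: "Const (sum f A) = (\<Sum>x\<in>A. Const (f x))"
  by (induction A rule: infinite_finite_induct) (auto simp: Const_add)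

lemma Const_power: "Const (a ^ n) = Const a ^ n"
  by (induction n) (auto simp: Const_mult)

lemma Const_eq_iff [simp]: "Const a = Const b \<longleftrightarrow> a = b"
  by (metis Const_def lookup_single_eq)

lemma Var_inject [simp]: "(Var v :: 'v cpoly) = Var w \<longleftrightarrow> v = w"
proof
  assume "(Var v :: 'v cpoly) = Var w"
  then have "Poly_Mapping.keys (Var v :: 'v cpoly) = Poly_Mapping.keys (Var w :: 'v cpoly)" by simp
  then have "Poly_Mapping.single v (1::nat) = Poly_Mapping.single w 1" by (simp add: Var_def)
  then have "Poly_Mapping.keys (Poly_Mapping.single v (1::nat)) = Poly_Mapping.keys (Poly_Mapping.single w (1::nat))" by simp
  then show "v = w" by simp
qed simp

text \<open>The target is an arbitrary commutative monoid so that the same product serves for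
  evaluating a monomial at polynomials and for writing it as a product of indeterminates.\<close>

definition mono_subst :: "('v \<Rightarrow> 'a::comm_monoid_mult) \<Rightarrow> ('v \<Rightarrow>\<^sub>0 nat) \<Rightarrow> 'a" where
  "mono_subst g t = (\<Prod>v\<in>Poly_Mapping.keys t. g v ^ Poly_Mapping.lookup t v)"

lemma mono_subst_superset:
  assumes "finite A" "Poly_Mapping.keys t \<subseteq> A"
  shows "mono_subst g t = (\<Prod>v\<in>A. g v ^ Poly_Mapping.lookup t v)"
  unfolding mono_subst_def using assms
  by (intro prod.mono_neutral_left) (auto simp: in_keys_iff)

lemma mono_subst_0 [simp]: "mono_subst g 0 = 1"
  by (simp add: mono_subst_def)

lemma mono_subst_single [simp]: "mono_subst g (Poly_Mapping.single v n) = g v ^ n"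
  by (simp add: mono_subst_def)

lemma mono_subst_add: "mono_subst g (s + t) = mono_subst g s * mono_subst g t"
proof -
  let ?A = "Poly_Mapping.keys s \<union> Poly_Mapping.keys t"
  have "mono_subst g (s + t) = (\<Prod>v\<in>?A. g v ^ Poly_Mapping.lookup (s + t) v)"
    using keys_add[of s t] by (intro mono_subst_superset) auto
  also have "\<dots> = (\<Prod>v\<in>?A. g v ^ Poly_Mapping.lookup s v) * (\<Prod>v\<in>?A. g v ^ Poly_Mapping.lookup t v)"
    by (simp add: lookup_add power_add prod.distrib)
  also have "\<dots> = mono_subst g s * mono_subst g t"
    by (simp add: mono_subst_superset[of ?A])
  finally show ?thesis .
qed

lemma single_eq_mono_subst_Var:
  fixes t :: "'v \<Rightarrow>\<^sub>0 nat"
  shows "Poly_Mapping.single t c = Const c * mono_subst Var t"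
proof -
  have pow: "(Var v :: 'v cpoly) ^ n = Poly_Mapping.single (Poly_Mapping.single v n) 1" for v :: 'v and n
    by (induction n) (auto simp: Var_def mult_single single_add[symmetric])
  have "(\<Prod>v\<in>A. (Var v :: 'v cpoly) ^ h v) =
      Poly_Mapping.single (\<Sum>v\<in>A. Poly_Mapping.single v (h v)) 1" if "finite A" for A :: "'v set" and h
    using that by (induction A) (auto simp: pow mult_single)
  from this[of "Poly_Mapping.keys t" "Poly_Mapping.lookup t"]
  have "(mono_subst Var t :: 'v cpoly) = Poly_Mapping.single t 1"
    unfolding mono_subst_def using poly_mapping_sum_single[of "Poly_Mapping.keys t" t] by simp
  then show ?thesis by (simp add: Const_def mult_single)
qed

text \<open>Polynomials with indeterminates in \<open>V\<close> are generated from constants by sums and by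
  multiplication with elements of \<open>V\<close>; most identities below are additive and need only be checked
  on that last step.\<close>

lemma cpoly_induct_in [consumes 1, case_names Const add Var]:
  fixes f :: "'v cpoly"
  assumes "poly_vars f \<subseteq> V"
    and C: "\<And>c. P (Const c)"
    and A: "\<And>f g. P f \<Longrightarrow> P g \<Longrightarrow> P (f + g)"
    and X: "\<And>v f. v \<in> V \<Longrightarrow> P f \<Longrightarrow> P (Var v * f)"
  shows "P f"
proof -
  have pow: "P (Var v ^ n * h)" if "v \<in> V" "P h" for v n h
    using that by (induction n) (auto simp: mult.assoc intro: X)
  have mon: "P ((\<Prod>v\<in>A. Var v ^ e v) * h)" if "finite A" "A \<subseteq> V" "P h" for A e h
    using that by (induction A) (auto simp: mult.assoc intro: pow)
  have "P (\<Sum>t\<in>A. Poly_Mapping.single t (Poly_Mapping.lookup f t))"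
    if "finite A" "A \<subseteq> Poly_Mapping.keys f" for A
    using that
  proof (induction A)
    case empty
    then show ?case using C[of 0] by simp
  next
    case (insert t A)
    have "Poly_Mapping.keys t \<subseteq> V" using assms(1) insert.prems by (auto simp: poly_vars_def)
    then have "P (Poly_Mapping.single t (Poly_Mapping.lookup f t))"
      unfolding single_eq_mono_subst_Var mono_subst_def using mon[OF _ _ C]
      by (simp add: mult.commute)
    then show ?case using insert by (auto intro: A)
  qed
  from this[of "Poly_Mapping.keys f"] show ?thesis
    using poly_mapping_sum_single[of "Poly_Mapping.keys f" f] by simp
qed

lemma cpoly_induct [case_names Const add Var]:
  fixes f :: "'v cpoly"
  assumes "\<And>c. P (Const c)" "\<And>f g. P f \<Longrightarrow> P g \<Longrightarrow> P (f + g)" "\<And>v f. P f \<Longrightarrow> P (Var v * f)"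
  shows "P f"
  using cpoly_induct_in[of f UNIV P] assms by simp

section \<open>Substitution as a ring homomorphism\<close>

lemma poly_subst_superset:
  assumes "finite A" "Poly_Mapping.keys f \<subseteq> A"
  shows "poly_subst g f = (\<Sum>t\<in>A. Const (Poly_Mapping.lookup f t) * mono_subst g t)"
  unfolding poly_subst_def mono_subst_def[symmetric] using assms
  by (intro sum.mono_neutral_left) (auto simp: in_keys_iff)

lemma poly_subst_add: "poly_subst g (f + h) = poly_subst g f + poly_subst g h"
proof -
  let ?A = "Poly_Mapping.keys f \<union> Poly_Mapping.keys h"
  have "poly_subst g (f + h) = (\<Sum>t\<in>?A. Const (Poly_Mapping.lookup (f + h) t) * mono_subst g t)"
    using keys_add[of f h] by (intro poly_subst_superset) auto
  also have "\<dots> = (\<Sum>t\<in>?A. Const (Poly_Mapping.lookup f t) * mono_subst g t)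
      + (\<Sum>t\<in>?A. Const (Poly_Mapping.lookup h t) * mono_subst g t)"
    by (simp add: lookup_add Const_add distrib_right sum.distrib)
  finally show ?thesis by (simp add: poly_subst_superset[of ?A])
qed

lemma poly_subst_single: "poly_subst g (Poly_Mapping.single t c) = Const c * mono_subst g t"
  using poly_subst_superset[of "{t}" "Poly_Mapping.single t c" g] by simp

lemma poly_subst_Const [simp]: "poly_subst g (Const c) = Const c"
  unfolding Const_def[of c] by (simp add: poly_subst_single) (simp add: Const_def)

lemma poly_subst_0 [simp]: "poly_subst g 0 = 0"
  by (simp add: poly_subst_def)

lemma poly_subst_1 [simp]: "poly_subst g 1 = 1"
  using poly_subst_Const[of g 1] by simp

lemma poly_subst_sum: "poly_subst g (sum h A) = (\<Sum>x\<in>A. poly_subst g (h x))"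
  by (induction A rule: infinite_finite_induct) (auto simp: poly_subst_add)

text \<open>Multiplying by one indeterminate shifts all monomials; induction then extends this to
  full multiplicativity.\<close>

lemma poly_subst_Var_mult: "poly_subst g (Var v * f) = g v * poly_subst g f"
proof -
  let ?K = "Poly_Mapping.keys f"
  have f: "f = (\<Sum>t\<in>?K. Poly_Mapping.single t (Poly_Mapping.lookup f t))"
    by (rule poly_mapping_sum_single) auto
  have "poly_subst g (Var v * f) =
      (\<Sum>t\<in>?K. poly_subst g (Var v * Poly_Mapping.single t (Poly_Mapping.lookup f t)))"
    by (subst f) (simp add: sum_distrib_left poly_subst_sum)
  also have "\<dots> = (\<Sum>t\<in>?K. g v * poly_subst g (Poly_Mapping.single t (Poly_Mapping.lookup f t)))"
    by (simp add: Var_def mult_single poly_subst_single mono_subst_add mult_ac)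
  also have "\<dots> = g v * poly_subst g f"
    by (subst (2) f) (simp add: sum_distrib_left poly_subst_sum)
  finally show ?thesis .
qed

lemma poly_subst_Var [simp]: "poly_subst g (Var v) = g v"
  using poly_subst_Var_mult[of g v 1] by simp

lemma poly_subst_mult: "poly_subst g (f * h) = poly_subst g f * poly_subst g h"
proof (induction f rule: cpoly_induct)
  case (Const c)
  show ?case
  proof (induction h rule: cpoly_induct)
    case (Const d)
    show ?case by (metis Const_mult poly_subst_Const)
  next
    case (Var v f)
    then show ?case
      by (simp only: mult.left_commute[of "Const c" "Var v"] poly_subst_Var_mult) (simp add: mult_ac)
  qed (simp add: distrib_left poly_subst_add)
qed (auto simp: distrib_right poly_subst_add mult.assoc poly_subst_Var_mult)

lemma comm_ring_hom_poly_subst: "comm_ring_hom (poly_subst g)"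
  by unfold_locales (auto simp: poly_subst_add poly_subst_mult)

interpretation poly_subst: comm_ring_hom "poly_subst g" for g
  by (rule comm_ring_hom_poly_subst)

lemma poly_subst_subst: "poly_subst g (poly_subst h f) = poly_subst (\<lambda>v. poly_subst g (h v)) f"
  by (induction f rule: cpoly_induct) (auto simp: poly_subst_add poly_subst_mult)

lemma poly_subst_Var_id: "poly_subst Var f = f"
  by (induction f rule: cpoly_induct) (auto simp: poly_subst_add poly_subst_mult)

section \<open>Occurring indeterminates\<close>

lemma finite_poly_vars [simp]: "finite (poly_vars f)"
  by (simp add: poly_vars_def)

lemma poly_vars_Const [simp]: "poly_vars (Const c) = {}"
  by (simp add: poly_vars_def Const_def)

lemma poly_vars_0 [simp]: "poly_vars 0 = {}" and poly_vars_1 [simp]: "poly_vars 1 = {}"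
  and poly_vars_of_nat [simp]: "poly_vars (of_nat n) = {}"
  using poly_vars_Const[of 0] poly_vars_Const[of 1] poly_vars_Const[of "of_nat n"]
  by (simp_all add: Const_of_nat)

lemma poly_vars_Var [simp]: "poly_vars (Var v) = {v}"
  by (simp add: poly_vars_def Var_def)

lemma poly_vars_add: "poly_vars f \<subseteq> V \<Longrightarrow> poly_vars g \<subseteq> V \<Longrightarrow> poly_vars (f + g) \<subseteq> V"
  unfolding poly_vars_def using keys_add[of f g] by blast

lemma poly_vars_mult: 
  assumes "poly_vars f \<subseteq> V" "poly_vars g \<subseteq> V" shows "poly_vars (f * g) \<subseteq> V"
proof
  fix v assume "v \<in> poly_vars (f * g)"
  then obtain s t where st: "s \<in> Poly_Mapping.keys f" "t \<in> Poly_Mapping.keys g"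
    "v \<in> Poly_Mapping.keys (s + t)"
    unfolding poly_vars_def using keys_mult[of f g] by blast
  then have "v \<in> Poly_Mapping.keys s \<union> Poly_Mapping.keys t" using keys_add[of s t] by auto
  then show "v \<in> V" using st assms by (auto simp: poly_vars_def)
qed

lemma poly_vars_sum: "(\<And>x. x \<in> A \<Longrightarrow> poly_vars (h x) \<subseteq> V) \<Longrightarrow> poly_vars (sum h A) \<subseteq> V"
proof (induction A rule: infinite_finite_induct)
  case (insert x A)
  then show ?case by (simp add: poly_vars_add)
qed auto

lemma poly_vars_prod: "(\<And>x. x \<in> A \<Longrightarrow> poly_vars (h x) \<subseteq> V) \<Longrightarrow> poly_vars (prod h A) \<subseteq> V"
proof (induction A rule: infinite_finite_induct)
  case (insert x A)
  then show ?case by (simp add: poly_vars_mult)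
qed auto

lemma poly_vars_diff:
  assumes "poly_vars f \<subseteq> V" "poly_vars g \<subseteq> V" shows "poly_vars (f - g) \<subseteq> V"
proof -
  have "f - g = f + Const (-1) * g" by (simp add: Const_uminus)
  also have "poly_vars \<dots> \<subseteq> V" using assms by (intro poly_vars_add poly_vars_mult) auto
  finally show ?thesis .
qed

lemma poly_vars_subst:
  assumes "poly_vars f \<subseteq> V" "\<And>v. v \<in> V \<Longrightarrow> poly_vars (g v) \<subseteq> W"
  shows "poly_vars (poly_subst g f) \<subseteq> W"
  using assms 
  by (induction f rule: cpoly_induct_in) (simp_all add: poly_subst_add poly_subst_mult poly_vars_add poly_vars_mult)

text \<open>By the Leibniz formula, the determinant lies in the subring generated by the entries.\<close>

lemma poly_vars_det:
  assumes "A \<in> carrier_mat n n" "\<And>i j. i < n \<Longrightarrow> j < n \<Longrightarrow> poly_vars (A $$ (i, j)) \<subseteq> V"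
  shows "poly_vars (det A) \<subseteq> V"
proof -
  have sg: "signof p = (1 :: 'a cpoly) \<or> signof p = (Const (-1) :: 'a cpoly)" for p :: "nat \<Rightarrow> nat"
    by (auto simp: sign_def Const_uminus)
  show ?thesis unfolding det_def'[OF assms(1)]
  proof (intro poly_vars_sum poly_vars_mult poly_vars_prod)
    fix p :: "nat \<Rightarrow> nat"
    show "poly_vars (signof p :: 'a cpoly) \<subseteq> V" using sg[of p] by auto
  next
    fix p i assume "p \<in> {p. p permutes {0..<n}}" "i \<in> {0..<n}"
    then show "poly_vars (A $$ (i, p i)) \<subseteq> V" using assms(2) 
      by (metis (no_types, lifting) atLeastLessThan_iff mem_Collect_eq permutes_in_image)
  qed
qed

section \<open>Derivations and the chain rule\<close>

text \<open>The operators \<open>\<partial>/\<partial>x\<close>, \<open>x\<^sub>i\<^sup>k \<theta>\<^sub>i\<close>, their sums, and \<open>t d/dt\<close> on power series all occur below;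
  the common abstraction is used for the product rule over finite products.\<close>

locale derivation =
  fixes D :: "'a::comm_ring_1 \<Rightarrow> 'a"
  assumes add: "D (f + g) = D f + D g"
    and mult: "D (f * g) = D f * g + f * D g"
begin

lemma zero [simp]: "D 0 = 0"
  using add[of 0 0] by simp

lemma one [simp]: "D 1 = 0"
  using mult[of 1 1] by simp

lemma minus: "D (f - g) = D f - D g"
  using add[of "f - g" g] by (simp add: algebra_simps)

lemma sum: "D (sum h A) = (\<Sum>x\<in>A. D (h x))"
  by (induction A rule: infinite_finite_induct) (auto simp: add)

lemma power: "D (f ^ n) = of_nat n * f ^ (n - 1) * D f"
proof (induction n)
  case (Suc n)
  then show ?case by (cases n) (auto simp: mult algebra_simps)
qed simp

text \<open>Logarithmic derivatives add up. Stating this with \<open>D h = e h\<close> avoids division; it is the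
  engine behind both the Newton recursion and the action on the Vandermonde product.\<close>

lemma prod_eigen:
  assumes "\<And>x. x \<in> A \<Longrightarrow> D (h x) = e x * h x"
  shows "D (prod h A) = sum e A * prod h A"
  using assms by (induction A rule: infinite_finite_induct) (auto simp: mult algebra_simps)

lemma scale: "derivation (\<lambda>f. c * D f)"
  by unfold_locales (auto simp: add mult algebra_simps)

end

lemma derivation_sum:
  assumes "\<And>i. i \<in> A \<Longrightarrow> derivation (D i)"
  shows "derivation (\<lambda>f. \<Sum>i\<in>A. D i f)"
proof
  fix f g
  show "(\<Sum>i\<in>A. D i (f + g)) = (\<Sum>i\<in>A. D i f) + (\<Sum>i\<in>A. D i g)"
    using assms by (simp add: derivation.add sum.distrib)
  show "(\<Sum>i\<in>A. D i (f * g)) = (\<Sum>i\<in>A. D i f) * g + f * (\<Sum>i\<in>A. D i g)"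
    using assms by (simp add: derivation.mult sum.distrib sum_distrib_left sum_distrib_right)
qed

text \<open>Only the monomial \<open>s + v\<close> of \<open>f\<close> can contribute to the coefficient at \<open>s\<close>: truncated subtraction
  also sends monomials without \<open>v\<close> to themselves, but these carry the factor 0.\<close>

lemma lookup_pderiv_var:
  "Poly_Mapping.lookup (pderiv_var v f) s =
     of_nat (Poly_Mapping.lookup s v + 1) * Poly_Mapping.lookup f (s + Poly_Mapping.single v 1)"
proof -
  let ?c = "\<lambda>t. of_nat (Poly_Mapping.lookup t v) * Poly_Mapping.lookup f t"
  let ?u = "s + Poly_Mapping.single v 1"
  have eq: "(if t - Poly_Mapping.single v 1 = s then ?c t else 0) = (if t = ?u then ?c t else 0)" for t
  proof (cases "Poly_Mapping.lookup t v = 0")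
    case True
    then have "t \<noteq> ?u" by (auto simp: lookup_add)
    with True show ?thesis by simp
  next
    case False
    have "t = (t - Poly_Mapping.single v 1) + Poly_Mapping.single v 1"
      by (rule poly_mapping_eqI) (use False in \<open>auto simp: lookup_add lookup_minus lookup_single when_def\<close>)
    then have "t - Poly_Mapping.single v 1 = s \<longleftrightarrow> t = ?u"
      by (metis add_diff_cancel_right')
    then show ?thesis by simp
  qed
  have "Poly_Mapping.lookup (pderiv_var v f) s =
      (\<Sum>t\<in>Poly_Mapping.keys f. if t - Poly_Mapping.single v 1 = s then ?c t else 0)"
    by (simp add: pderiv_var_def lookup_sum lookup_single when_def)
  also have "\<dots> = (if ?u \<in> Poly_Mapping.keys f then ?c ?u else 0)"
    unfolding eq by (subst sum.delta) auto
  also have "\<dots> = ?c ?u" by (auto simp: in_keys_iff)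
  finally show ?thesis by (simp add: lookup_add)
qed

lemma pderiv_var_add: "pderiv_var v (f + g) = pderiv_var v f + pderiv_var v g"
  by (rule poly_mapping_eqI) (simp add: lookup_pderiv_var lookup_add algebra_simps)

lemma pderiv_var_notin: "v \<notin> poly_vars f \<Longrightarrow> pderiv_var v f = 0"
proof (rule poly_mapping_eqI)
  fix s assume "v \<notin> poly_vars f"
  then have "s + Poly_Mapping.single v 1 \<notin> Poly_Mapping.keys f"
    by (auto simp: poly_vars_def in_keys_iff[of v] lookup_add)
  then show "Poly_Mapping.lookup (pderiv_var v f) s = Poly_Mapping.lookup 0 s"
    by (simp add: lookup_pderiv_var in_keys_iff)
qed

lemma pderiv_var_Const [simp]: "pderiv_var v (Const c) = 0"
  by (rule pderiv_var_notin) simp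

lemma poly_vars_pderiv: "poly_vars f \<subseteq> V \<Longrightarrow> poly_vars (pderiv_var v f) \<subseteq> V"
proof
  fix w assume f: "poly_vars f \<subseteq> V" and "w \<in> poly_vars (pderiv_var v f)"
  then obtain s where s: "w \<in> Poly_Mapping.keys s" "Poly_Mapping.lookup (pderiv_var v f) s \<noteq> 0"
    by (auto simp: poly_vars_def in_keys_iff)
  then have "s + Poly_Mapping.single v 1 \<in> Poly_Mapping.keys f" by (auto simp: lookup_pderiv_var in_keys_iff)
  moreover have "w \<in> Poly_Mapping.keys (s + Poly_Mapping.single v 1)"
    using s(1) by (auto simp: in_keys_iff lookup_add)
  ultimately show "w \<in> V" using f by (auto simp: poly_vars_def)
qed

lemma pderiv_var_single: "pderiv_var v (Poly_Mapping.single t c) =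
    Poly_Mapping.single (t - Poly_Mapping.single v 1) (of_nat (Poly_Mapping.lookup t v) * c)"
  by (cases "c = 0") (auto simp: pderiv_var_def)

lemma pderiv_var_sum: "pderiv_var v (sum h A) = (\<Sum>x\<in>A. pderiv_var v (h x))"
  by (induction A rule: infinite_finite_induct) (auto simp: pderiv_var_add pderiv_var_notin)

lemma pderiv_var_Var_mult:
  "pderiv_var v (Var w * f) = (if v = w then f else 0) + Var w * pderiv_var v f"
proof -
  have 1: "pderiv_var v (Var w * Poly_Mapping.single t c) =
      (if v = w then Poly_Mapping.single t c else 0) + Var w * pderiv_var v (Poly_Mapping.single t c)" for t c
  proof (cases "Poly_Mapping.lookup t v = 0")
    case True
    then show ?thesis
      by (auto simp: Var_def mult_single pderiv_var_single lookup_add lookup_single when_def)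
  next
    case False
    have "Poly_Mapping.single w 1 + (t - Poly_Mapping.single v 1) = Poly_Mapping.single w 1 + t - Poly_Mapping.single v 1"
      by (rule poly_mapping_eqI) (use False in \<open>auto simp: lookup_add lookup_minus lookup_single when_def\<close>)
    then show ?thesis using False
      by (auto simp: Var_def mult_single pderiv_var_single lookup_add lookup_single when_def algebra_simps
          single_add)
  qed
  let ?K = "Poly_Mapping.keys f"
  have f: "f = (\<Sum>t\<in>?K. Poly_Mapping.single t (Poly_Mapping.lookup f t))"
    by (rule poly_mapping_sum_single) auto
  have "pderiv_var v (Var w * f) =
      (\<Sum>t\<in>?K. pderiv_var v (Var w * Poly_Mapping.single t (Poly_Mapping.lookup f t)))"
    by (subst f) (simp add: sum_distrib_left pderiv_var_sum)
  also have "\<dots> = (if v = w then f else 0) + Var w * pderiv_var v f"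
    by (subst (2 3) f) (simp add: 1 sum.distrib sum_distrib_left pderiv_var_sum)
  finally show ?thesis .
qed

lemma pderiv_var_Var: "pderiv_var v (Var w) = (if v = w then 1 else 0)"
  using pderiv_var_Var_mult[of v w 1] pderiv_var_Const[of v 1] by simp

lemma pderiv_var_mult: "pderiv_var v (f * h) = pderiv_var v f * h + f * pderiv_var v h"
proof (induction f rule: cpoly_induct)
  case (Const c)
  show ?case
  proof (induction h rule: cpoly_induct)
    case (Const d)
    show ?case by (metis Const_mult pderiv_var_Const mult_zero_left mult_zero_right add_0)
  next
    case (Var w f)
    then show ?case
      by (simp only: mult.left_commute[of "Const c" "Var w"] pderiv_var_Var_mult) (simp add: algebra_simps)
  qed (simp add: distrib_left pderiv_var_add)
qed (auto simp: distrib_right distrib_left mult.assoc pderiv_var_add pderiv_var_Var_mult)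

interpretation pderiv: derivation "pderiv_var v" for v :: 'v
  by unfold_locales (auto simp: pderiv_var_add pderiv_var_mult)

lemma pderiv_var_Const_mult: "pderiv_var v (Const c * f) = Const c * pderiv_var v f"
  by (simp add: pderiv_var_mult)

text \<open>Both sides are derivations along \<open>poly_subst g\<close> that agree on indeterminates.\<close>

lemma chain_rule:
  fixes D :: "'w cpoly \<Rightarrow> 'w cpoly" and g :: "'v \<Rightarrow> 'w cpoly"
  assumes "derivation D" and D0: "\<And>c. D (Const c) = 0"
    and "finite V" "poly_vars f \<subseteq> V"
  shows "D (poly_subst g f) = (\<Sum>v\<in>V. poly_subst g (pderiv_var v f) * D (g v))"
proof -
  interpret derivation D by fact
  from assms(4) show ?thesis
  proof (induction f rule: cpoly_induct_in)
    case (Var v f)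
    have "(\<Sum>u\<in>V. poly_subst g (pderiv_var u (Var v * f)) * D (g u)) =
      (\<Sum>u\<in>V. (if u = v then poly_subst g f * D (g v) else 0) + g v * (poly_subst g (pderiv_var u f) * D (g u)))"
      by (intro sum.cong) (auto simp: pderiv_var_Var_mult poly_subst_add poly_subst_mult distrib_right mult.assoc)
    then show ?case using Var \<open>finite V\<close>
      by (simp add: poly_subst_mult mult sum.distrib sum_distrib_left mult.commute)
  qed (auto simp: D0 poly_subst_add add pderiv_var_add distrib_right sum.distrib)
qed

section \<open>The Vandermonde determinant\<close>

lemma coeff_prod_linear:
  fixes x :: "'i \<Rightarrow> 'a::comm_ring_1"
  assumes "finite S"
  shows "(card S < n \<longrightarrow> coeff (\<Prod>l\<in>S. [:- x l, 1:]) n = 0) \<and> coeff (\<Prod>l\<in>S. [:- x l, 1:]) (card S) = 1"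
  using assms
proof (induction S arbitrary: n)
  case (insert a S)
  have step: "coeff ([:- x a, 1:] * p) (Suc k) = coeff p k - x a * coeff p (Suc k)" for p k
    by simp
  show ?case
  proof (intro conjI impI)
    assume "card (insert a S) < n"
    then obtain k where "n = Suc k" "card S < k" using insert.hyps by (cases n) auto
    then show "coeff (\<Prod>l\<in>insert a S. [:- x l, 1:]) n = 0"
      using insert.hyps insert.IH[of k] insert.IH[of "Suc k"] by (simp add: step del: mult_pCons_left)
  next
    show "coeff (\<Prod>l\<in>insert a S. [:- x l, 1:]) (card (insert a S)) = 1"
      using insert.hyps insert.IH[of "Suc (card S)"] by (simp add: step del: mult_pCons_left)
  qed
qed auto

lemma poly_eq_sum_lessThan:
  fixes p :: "'a::comm_ring_1 poly"
  assumes "\<And>n. N \<le> n \<Longrightarrow> coeff p n = 0"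
  shows "poly p a = (\<Sum>r<N. coeff p r * a ^ r)"
proof -
  have "(\<Sum>r\<le>degree p. coeff p r * a ^ r) = (\<Sum>r\<in>{..degree p} \<union> {..<N}. coeff p r * a ^ r)"
    by (rule sum.mono_neutral_left) (auto simp: coeff_eq_0)
  also have "\<dots> = (\<Sum>r<N. coeff p r * a ^ r)"
    by (rule sum.mono_neutral_right) (auto simp: assms)
  finally show ?thesis by (simp add: poly_altdef)
qed

text \<open>Multiply the matrix of powers from the right by the coefficients of the monic polynomials
  \<open>f\<^sub>j = \<Prod>l>j. (X - x\<^sub>l)\<close>. The coefficient matrix is unitriangular by degrees, and the product
  \<open>(f\<^sub>j(x\<^sub>i))\<close> is triangular because \<open>x\<^sub>i\<close> is a root of \<open>f\<^sub>j\<close> for \<open>i > j\<close>. No induction on the size and no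
  cancellation is involved, so the identity holds over every commutative ring.\<close>

lemma vandermonde_det:
  fixes x :: "nat \<Rightarrow> 'a::comm_ring_1"
  shows "det (mat N N (\<lambda>(i, j). x i ^ (N - Suc j))) = (\<Prod>i<N. \<Prod>l\<in>{Suc i..<N}. x i - x l)"
proof -
  define f where "f = (\<lambda>j. \<Prod>l\<in>{Suc j..<N}. [:- x l, 1:])"
  define A where "A = mat N N (\<lambda>(i, j). x i ^ (N - Suc j))"
  define C where "C = mat N N (\<lambda>(r, j). coeff (f j) (N - Suc r))"
  have f0: "coeff (f j) n = 0" if "N - Suc j < n" for j n
    using coeff_prod_linear[of "{Suc j..<N}" n x] that by (auto simp: f_def)
  have f1: "coeff (f j) (N - Suc j) = 1" for j
    using coeff_prod_linear[of "{Suc j..<N}" 0 x] by (auto simp: f_def)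
  have [simp]: "A \<in> carrier_mat N N" "C \<in> carrier_mat N N" "dim_row A = N" "dim_col C = N"
    by (auto simp: A_def C_def)
  have "det C = prod_list (diag_mat C)"
    by (rule det_lower_triangular[of N]) (auto simp: C_def intro!: f0)
  also have "\<dots> = 1" by (simp add: prod_list_diag_prod C_def f1)
  finally have detC: "det C = 1" .
  have AC: "(A * C) $$ (i, j) = poly (f j) (x i)" if "i < N" "j < N" for i j
  proof -
    have "(A * C) $$ (i, j) = (\<Sum>r<N. x i ^ (N - Suc r) * coeff (f j) (N - Suc r))"
      using that by (simp add: A_def C_def scalar_prod_def atLeast0LessThan)
    also have "\<dots> = (\<Sum>r<N. x i ^ r * coeff (f j) r)"
      by (rule sum.nat_diff_reindex)
    also have "\<dots> = poly (f j) (x i)"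
      using f0[of j] that by (subst poly_eq_sum_lessThan[of N]) (auto simp: mult.commute)
    finally show ?thesis .
  qed
  have AC0: "(A * C) $$ (i, j) = 0" if "j < i" "i < N" for i j
  proof -
    have "poly (f j) (x i) = 0"
      using that by (auto simp: f_def poly_prod intro!: prod_zero)
    then show ?thesis using AC[of i j] that by simp
  qed
  have "det (A * C) = prod_list (diag_mat (A * C))"
    by (rule det_upper_triangular[of _ N]) (auto simp: AC0 upper_triangular_def simp del: index_mult_mat(1))
  also have "\<dots> = (\<Prod>i<N. poly (f i) (x i))"
    by (simp add: prod_list_diag_prod AC atLeast0LessThan del: index_mult_mat(1))
  also have "\<dots> = (\<Prod>i<N. \<Prod>l\<in>{Suc i..<N}. x i - x l)" by (simp add: f_def poly_prod)
  finally show ?thesis using detC det_mult[of A N C] by (simp add: A_def)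
qed

section \<open>Complete homogeneous polynomials and the Jacobi--Trudi identity\<close>

lemma fps_nth_prod_linear:
  fixes x :: "'i \<Rightarrow> 'a::comm_ring_1"
  assumes "finite S"
  shows "(card S < n \<longrightarrow> fps_nth (\<Prod>l\<in>S. 1 - fps_const (x l) * fps_X) n = 0)
    \<and> fps_nth (\<Prod>l\<in>S. 1 - fps_const (x l) * fps_X) 0 = 1"
  using assms
proof (induction S arbitrary: n)
  case (insert a S)
  have step: "fps_nth ((1 - fps_const (x a) * fps_X) * p) (Suc k) = fps_nth p (Suc k) - x a * fps_nth p k" for p k
    by (simp add: algebra_simps)
  show ?case
  proof (intro conjI impI)
    assume "card (insert a S) < n"
    then obtain k where "n = Suc k" "card S < k" using insert.hyps by (cases n) auto
    then show "fps_nth (\<Prod>l\<in>insert a S. 1 - fps_const (x l) * fps_X) n = 0"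
      using insert.hyps insert.IH[of k] insert.IH[of "Suc k"] by (simp add: step del: fps_mult_nth)
  next
    show "fps_nth (\<Prod>l\<in>insert a S. 1 - fps_const (x l) * fps_X) 0 = 1"
      using insert.hyps insert.IH[of 0] by simp
  qed
qed auto

lemma fps_geometric:
  fixes c :: "'a::comm_ring_1"
  shows "(1 - fps_const c * fps_X) * Abs_fps (\<lambda>n. c ^ n) = 1"
proof (rule fps_ext)
  fix n
  show "fps_nth ((1 - fps_const c * fps_X) * Abs_fps (\<lambda>n. c ^ n)) n = fps_nth 1 n"
    by (cases n) (auto simp: left_diff_distrib mult.assoc)
qed

text \<open>Newton's recursion says \<open>t H' = P H\<close> for \<open>H = \<Sum>h\<^sub>n t\<^sup>n\<close> and \<open>P = \<Sum>p\<^sub>n t\<^sup>n\<close>, while the product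
  \<open>E = \<Prod>(1 - x\<^sub>l t)\<close> satisfies \<open>t E' = - P E\<close>. Hence \<open>(H E)' = 0\<close>, and \<open>H E\<close> is its constant term 1.\<close>

lemma complete_homogeneous_of_power_sums:
  fixes x :: "nat \<Rightarrow> 'a::{idom, ring_char_0}" and h :: "nat \<Rightarrow> 'a"
  assumes h0: "h 0 = 1"
    and hS: "\<And>n. of_nat (Suc n) * h (Suc n) = (\<Sum>r\<le>n. (\<Sum>l<N. x l ^ Suc r) * h (n - r))"
  shows "Abs_fps h * (\<Prod>l<N. 1 - fps_const (x l) * fps_X) = 1"
proof -
  let ?E = "\<Prod>l<N. 1 - fps_const (x l) * fps_X" and ?H = "Abs_fps h"
  define D where "D = (\<lambda>f :: 'a fps. fps_X * fps_deriv f)"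
  \<comment> \<open>The part of the power sum series that comes from the single variable \<open>x l\<close>.\<close>
  define g where "g = (\<lambda>l. Abs_fps (\<lambda>n. if n = 0 then 0 else x l ^ n))"
  interpret D: derivation D
    by unfold_locales (auto simp: D_def algebra_simps)
  have "D (1 - fps_const (x l) * fps_X) = - g l * (1 - fps_const (x l) * fps_X)" for l
  proof -
    have g: "g l = fps_const (x l) * fps_X * Abs_fps (\<lambda>n. x l ^ n)"
      by (rule fps_ext) (auto simp: g_def mult.assoc power_eq_if)
    have "g l * (1 - fps_const (x l) * fps_X) =
        fps_const (x l) * fps_X * ((1 - fps_const (x l) * fps_X) * Abs_fps (\<lambda>n. x l ^ n))"
      unfolding g by (simp only: mult_ac)
    also have "\<dots> = fps_const (x l) * fps_X" by (simp only: fps_geometric mult_1_right)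
    finally have "- g l * (1 - fps_const (x l) * fps_X) = - (fps_const (x l) * fps_X)"
      by (simp only: mult_minus_left)
    moreover have "D (1 - fps_const (x l) * fps_X) = - (fps_const (x l) * fps_X)"
      by (simp add: D_def mult.commute flip: fps_const_neg)
    ultimately show ?thesis by simp
  qed
  then have DE: "D ?E = (\<Sum>l<N. - g l) * ?E" by (rule D.prod_eigen)
  have DH: "D ?H = (\<Sum>l<N. g l) * ?H"
  proof (rule fps_ext)
    fix n
    show "fps_nth (D ?H) n = fps_nth ((\<Sum>l<N. g l) * ?H) n"
    proof (cases n)
      case (Suc k)
      have "fps_nth ((\<Sum>l<N. g l) * ?H) n = (\<Sum>i=0..Suc k. (\<Sum>l<N. fps_nth (g l) i) * h (Suc k - i))"
        by (simp add: fps_mult_nth fps_sum_nth Suc)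
      also have "\<dots> = (\<Sum>r\<le>k. (\<Sum>l<N. x l ^ Suc r) * h (k - r))"
        unfolding sum.atLeast0_atMost_Suc_shift by (simp add: g_def atMost_atLeast0 del: power_Suc)
      finally show ?thesis using hS[of k] Suc by (simp add: D_def)
    qed (simp add: D_def g_def fps_sum_nth)
  qed
  have "D (?H * ?E) = 0" unfolding D.mult DE DH by (simp add: sum_negf algebra_simps)
  moreover have "fps_nth (D F) n = of_nat n * fps_nth F n" for F n
    by (cases n) (auto simp: D_def)
  ultimately have n: "of_nat n * fps_nth (?H * ?E) n = 0" for n
    by (metis fps_zero_nth)
  show ?thesis
  proof (rule fps_ext)
    fix n
    show "fps_nth (?H * ?E) n = fps_nth 1 n"
    proof (cases n)
      case 0
      then show ?thesis using fps_nth_prod_linear[of "{..<N}" 0 x] h0 by simp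
    next
      case (Suc k)
      have "of_nat n \<noteq> (0::'a)" unfolding Suc of_nat_eq_0_iff by simp
      then show ?thesis using n[of n] Suc by (simp del: of_nat_Suc)
    qed
  qed
qed

text \<open>Let \<open>E\<^sub>k\<close> be the product of all \<open>1 - x\<^sub>l t\<close> with \<open>l \<noteq> k\<close>. From \<open>H E\<^sub>k (1 - x\<^sub>k t) = 1\<close> it follows
  that \<open>H E\<^sub>k\<close> is the geometric series of \<open>x\<^sub>k\<close>, that is, every power of \<open>x\<^sub>k\<close> is a combination of \<open>N\<close>
  consecutive coefficients of \<open>H\<close> whose weights, the coefficients of \<open>E\<^sub>k\<close>, do not depend on the
  exponent. So the alternant matrix factors as \<open>M J\<close> with \<open>M\<close> independent of \<open>mu\<close>. For \<open>mu = 0\<close> the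
  factor \<open>J\<close> is unitriangular, which identifies \<open>det M\<close> with the Vandermonde determinant.\<close>

lemma jacobi_trudi:
  fixes x :: "nat \<Rightarrow> 'a::comm_ring_1"
  assumes H: "H * (\<Prod>l<N. 1 - fps_const (x l) * fps_X) = 1"
  shows "det (mat N N (\<lambda>(i, j). x i ^ (mu j + (N - Suc j)))) =
    det (mat N N (\<lambda>(i, j). if j \<le> mu j + i then fps_nth H (mu j + i - j) else 0)) *
    det (mat N N (\<lambda>(i, j). x i ^ (N - Suc j)))"
proof -
  define E where "E = (\<lambda>k. \<Prod>l\<in>{..<N} - {k}. 1 - fps_const (x l) * fps_X)"
  define M where "M = mat N N (\<lambda>(k, r). fps_nth (E k) (N - Suc r))"
  define J where "J = (\<lambda>mu. mat N N (\<lambda>(i, j). if j \<le> mu j + i then fps_nth H (mu j + i - j) else 0))"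
  have [simp]: "M \<in> carrier_mat N N" "J mu \<in> carrier_mat N N" for mu
    by (auto simp: M_def J_def)
  have E0: "fps_nth (E k) n = 0" if "k < N" "N \<le> n" for k n
    using fps_nth_prod_linear[of "{..<N} - {k}" n x] that by (auto simp: E_def)
  have geom: "H * E k = Abs_fps (\<lambda>n. x k ^ n)" if "k < N" for k
  proof -
    have "(\<Prod>l<N. 1 - fps_const (x l) * fps_X) = (1 - fps_const (x k) * fps_X) * E k"
      unfolding E_def using that by (subst prod.remove[of _ k]) auto
    then have "H * E k * ((1 - fps_const (x k) * fps_X) * Abs_fps (\<lambda>n. x k ^ n)) = Abs_fps (\<lambda>n. x k ^ n)"
      using H by (metis (no_types, lifting) mult.assoc mult.commute mult.left_neutral)
    then show ?thesis by (simp add: fps_geometric)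
  qed
  have MJ: "M * J mu = mat N N (\<lambda>(i, j). x i ^ (mu j + (N - Suc j)))" for mu
  proof (rule eq_matI)
    fix k j
    assume "k < dim_row (mat N N (\<lambda>(i, j). x i ^ (mu j + (N - Suc j))))"
      "j < dim_col (mat N N (\<lambda>(i, j). x i ^ (mu j + (N - Suc j))))"
    then have kj: "k < N" "j < N" by auto
    let ?n = "mu j + (N - Suc j)"
    \<comment> \<open>Row \<open>r\<close> of \<open>J\<close> is paired with the coefficient at \<open>N - 1 - r\<close>; reversing the sum gives a Cauchy product.\<close>
    have "(M * J mu) $$ (k, j) = (\<Sum>r<N. fps_nth (E k) (N - Suc r) *
        (if j \<le> mu j + r then fps_nth H (mu j + r - j) else 0))"
      using kj by (simp add: M_def J_def scalar_prod_def atLeast0LessThan)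
    also have "\<dots> = (\<Sum>r<N. fps_nth (E k) (N - Suc r) *
        (if N - Suc r \<le> ?n then fps_nth H (?n - (N - Suc r)) else 0))"
    proof (rule sum.cong[OF refl])
      fix r assume "r \<in> {..<N}"
      then have "j \<le> mu j + r \<longleftrightarrow> N - Suc r \<le> ?n" "mu j + r - j = ?n - (N - Suc r)"
        using kj by auto
      then show "fps_nth (E k) (N - Suc r) * (if j \<le> mu j + r then fps_nth H (mu j + r - j) else 0) =
        fps_nth (E k) (N - Suc r) * (if N - Suc r \<le> ?n then fps_nth H (?n - (N - Suc r)) else 0)"
        by simp
    qed
    also have "\<dots> = (\<Sum>s<N. fps_nth (E k) s * (if s \<le> ?n then fps_nth H (?n - s) else 0))"
      by (rule sum.nat_diff_reindex)
    also have "\<dots> = (\<Sum>s\<in>{..<N} \<union> {0..?n}. fps_nth (E k) s * (if s \<le> ?n then fps_nth H (?n - s) else 0))"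
      using kj by (intro sum.mono_neutral_left) (auto simp: E0)
    also have "\<dots> = (\<Sum>s=0..?n. fps_nth (E k) s * (if s \<le> ?n then fps_nth H (?n - s) else 0))"
      by (intro sum.mono_neutral_right) auto
    also have "\<dots> = fps_nth (E k * H) ?n"
      unfolding fps_mult_nth by (rule sum.cong) auto
    also have "\<dots> = x k ^ ?n" using geom[OF kj(1)] by (simp add: mult.commute)
    finally show "(M * J mu) $$ (k, j) = mat N N (\<lambda>(i, j). x i ^ (mu j + (N - Suc j))) $$ (k, j)"
      using kj by simp
  qed (auto simp: M_def J_def)
  have H0: "fps_nth H 0 = 1"
    using arg_cong[OF H, of "\<lambda>f. fps_nth f 0"] fps_nth_prod_linear[of "{..<N}" 0 x] by simp
  have "det (J (\<lambda>_. 0)) = prod_list (diag_mat (J (\<lambda>_. 0)))"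
    by (rule det_lower_triangular[of N]) (auto simp: J_def)
  also have "\<dots> = 1" by (simp add: prod_list_diag_prod J_def H0)
  finally have "det M = det (M * J (\<lambda>_. 0))" by (simp add: det_mult[of M N])
  also have "\<dots> = det (mat N N (\<lambda>(i, j). x i ^ (N - Suc j)))" by (simp add: MJ)
  finally have detM: "det M = \<dots>" .
  have "det (M * J mu) = det M * det (J mu)" by (rule det_mult[of M N]) auto
  then show ?thesis unfolding MJ detM by (simp add: J_def mult.commute)
qed

section \<open>Algebraic independence of the power sums\<close>

text \<open>Jacobian criterion, organised as an induction on the degree. If \<open>f(p\<^sub>1, \<dots>, p\<^sub>N) = 0\<close>, then the
  derivative with respect to \<open>x\<^sub>i\<close> gives \<open>\<Sum>\<^sub>k k (\<partial>\<^sub>k f)(p) x\<^sub>i\<^sup>k\<^sup>-\<^sup>1 = 0\<close> for every \<open>i < N\<close>. So a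
  univariate polynomial of degree less than \<open>N\<close> has the \<open>N\<close> distinct roots \<open>x\<^sub>i\<close>, and each \<open>(\<partial>\<^sub>k f)(p)\<close> vanishes; by induction all \<open>\<partial>\<^sub>k f\<close>
  vanish and \<open>f\<close> is constant.\<close>

lemma power_sums_algebraically_independent:
  assumes "poly_vars f \<subseteq> {1..N}" "poly_subst (power_sum N) f = 0"
  shows "f = 0"
proof -
  define deg where "deg = (\<lambda>t :: nat \<Rightarrow>\<^sub>0 nat. \<Sum>v\<in>{1..N}. Poly_Mapping.lookup t v)"
  have "f = 0" if "\<And>t. t \<in> Poly_Mapping.keys f \<Longrightarrow> deg t < d" for d
    using assms that
  proof (induction d arbitrary: f)
    case 0
    then have "Poly_Mapping.keys f = {}" by (meson equals0I not_less_zero)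
    then show ?case by simp
  next
    case (Suc d)
    have image: "poly_subst (power_sum N) (pderiv_var k f) = 0" if k: "k \<in> {1..N}" for k
    proof -
      \<comment> \<open>The univariate polynomial with coefficients \<open>k (\<partial>\<^sub>k f)(p)\<close> that vanishes at all \<open>x\<^sub>i\<close>.\<close>
      define p where "p = (\<Sum>k\<in>{1..N}. monom (of_nat k * poly_subst (power_sum N) (pderiv_var k f)) (k - 1))"
      have root: "poly p (Var i) = 0" if "i < N" for i
      proof -
        have "pderiv_var i (power_sum N k) = of_nat k * Var i ^ (k - 1)" for k
        proof -
          have "pderiv_var i (power_sum N k) = (\<Sum>j<N. if j = i then of_nat k * Var i ^ (k - 1) else 0)"
            unfolding power_sum_def pderiv.sum
            by (intro sum.cong) (auto simp: pderiv.power pderiv_var_Var)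
          then show ?thesis using that by simp
        qed
        moreover have "0 = (\<Sum>k\<in>{1..N}. poly_subst (power_sum N) (pderiv_var k f) * pderiv_var i (power_sum N k))"
          using chain_rule[OF pderiv.derivation_axioms _ _ Suc.prems(1), of i "power_sum N"] Suc.prems(2)
          by simp
        ultimately show ?thesis
          by (simp add: p_def poly_sum poly_monom mult_ac)
      qed
      have "degree p \<le> N - 1"
        unfolding p_def by (intro degree_sum_le) (auto intro: order.trans[OF degree_monom_le])
      then have "degree p < card (Var ` {..<N} :: nat cpoly set)"
        using k by (subst card_image) (auto simp: inj_on_def)
      then have "p = 0"
        using root by (intro poly_eqI_degree[of "Var ` {..<N}"]) auto
      then have "0 = coeff p (k - 1)" by simp
      also have "\<dots> = (\<Sum>j\<in>{1..N}. if j = k then of_nat k * poly_subst (power_sum N) (pderiv_var k f) else 0)"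
        unfolding p_def coeff_sum using k by (intro sum.cong) auto
      also have "\<dots> = of_nat k * poly_subst (power_sum N) (pderiv_var k f)" using k by simp
      finally show ?thesis using k by simp
    qed
    have deriv: "pderiv_var k f = 0" if k: "k \<in> {1..N}" for k
    proof (rule Suc.IH[OF poly_vars_pderiv[OF Suc.prems(1)] image[OF k]])
      fix s assume "s \<in> Poly_Mapping.keys (pderiv_var k f)"
      then have "s + Poly_Mapping.single k 1 \<in> Poly_Mapping.keys f"
        by (auto simp: in_keys_iff lookup_pderiv_var)
      then have "deg (s + Poly_Mapping.single k 1) < Suc d" by (rule Suc.prems)
      then show "deg s < d"
        using k by (simp add: deg_def lookup_add lookup_single when_def sum.distrib)
    qed
    have const: "t = 0" if t: "t \<in> Poly_Mapping.keys f" for t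
    proof (rule ccontr)
      assume "t \<noteq> 0"
      then obtain v where v: "v \<in> Poly_Mapping.keys t" by fastforce
      then have "v \<in> {1..N}" using t Suc.prems(1) by (auto simp: poly_vars_def)
      have "(t - Poly_Mapping.single v 1) + Poly_Mapping.single v 1 = t"
        by (rule poly_mapping_eqI)
          (use v in \<open>auto simp: lookup_add lookup_minus lookup_single when_def in_keys_iff\<close>)
      then have "Poly_Mapping.lookup (pderiv_var v f) (t - Poly_Mapping.single v 1) \<noteq> 0"
        using t by (simp add: lookup_pderiv_var in_keys_iff del: of_nat_add of_nat_Suc)
      then show False using deriv[OF \<open>v \<in> {1..N}\<close>] by simp
    qed
    then have "f = Const (Poly_Mapping.lookup f 0)"
      using poly_mapping_sum_single[of "{0}" f] by (auto simp: Const_def)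
    then show ?case using Suc.prems(2) by (metis poly_subst_Const)
  qed
  moreover have "deg t < Suc (\<Sum>t\<in>Poly_Mapping.keys f. deg t)" if "t \<in> Poly_Mapping.keys f" for t
    using that member_le_sum[of t "Poly_Mapping.keys f" deg] by simp
  ultimately show ?thesis by blast
qed

section \<open>Existence and uniqueness of Schur polynomials\<close>

text \<open>The complete homogeneous polynomial \<open>h\<^sub>n\<close> in terms of power sums, by Newton's recursion
  \<open>n h\<^sub>n = \<Sum> p\<^sub>r h\<^sub>n\<^sub>-\<^sub>r\<close>; it is the same polynomial for any number of variables.\<close>

fun complete_q :: "nat \<Rightarrow> nat cpoly" where
  "complete_q 0 = 1"
| "complete_q (Suc n) = Const (1 / of_nat (Suc n)) * (\<Sum>r\<le>n. Var (Suc r) * complete_q (n - r))"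

lemma complete_q_rec: "of_nat (Suc n) * complete_q (Suc n) = (\<Sum>r\<le>n. Var (Suc r) * complete_q (n - r))"
proof -
  have "of_nat (Suc n) * Const (1 / of_nat (Suc n)) = (1 :: nat cpoly)"
    unfolding Const_of_nat[symmetric] Const_mult[symmetric] by (simp del: of_nat_Suc)
  then show ?thesis by (simp add: mult.assoc[symmetric] del: of_nat_Suc)
qed

declare complete_q.simps(2) [simp del]

lemma poly_vars_complete_q: "poly_vars (complete_q n) \<subseteq> {1..}"
proof (induction n rule: less_induct)
  case (less n)
  show ?case
  proof (cases n)
    case (Suc k)
    have "poly_vars (Const (1 / of_nat (Suc k)) * (\<Sum>r\<le>k. Var (Suc r) * complete_q (k - r))) \<subseteq> {1..}"
      using less Suc by (intro poly_vars_mult poly_vars_sum) auto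
    then show ?thesis by (simp only: Suc complete_q.simps(2))
  qed simp
qed

text \<open>The Jacobi--Trudi determinant \<open>det (h (\<lambda>\<^sub>j - j + i))\<close>, with \<open>h\<close> equal to 0 at negative indices.\<close>

definition jacobi_trudi_det :: "nat \<Rightarrow> (nat \<Rightarrow> nat) \<Rightarrow> nat cpoly" where
  "jacobi_trudi_det N lam = det (mat N N (\<lambda>(i, j). if j \<le> lam (Suc j) + i then complete_q (lam (Suc j) + i - j) else 0))"

lemma poly_vars_jacobi_trudi_det: "poly_vars (jacobi_trudi_det N lam) \<subseteq> {1..}"
  unfolding jacobi_trudi_det_def using poly_vars_complete_q
  by (intro poly_vars_det[of _ N]) auto

text \<open>A vanishing part contributes a last column that is zero above a final entry \<open>h 0 = 1\<close>.\<close>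

lemma jacobi_trudi_det_Suc:
  assumes "lam (Suc N) = 0"
  shows "jacobi_trudi_det (Suc N) lam = jacobi_trudi_det N lam"
proof -
  define A where "A = mat (Suc N) (Suc N) (\<lambda>(i, j). if j \<le> lam (Suc j) + i then complete_q (lam (Suc j) + i - j) else 0)"
  have "det A = (\<Sum>i<Suc N. A $$ (i, N) * cofactor A i N)"
    by (rule laplace_expansion_column) (auto simp: A_def)
  also have "\<dots> = (\<Sum>i<Suc N. if i = N then cofactor A N N else 0)"
    using assms by (intro sum.cong) (auto simp: A_def)
  also have "\<dots> = det (mat_delete A N N)" by (simp add: cofactor_def)
  also have "mat_delete A N N = mat N N (\<lambda>(i, j). if j \<le> lam (Suc j) + i then complete_q (lam (Suc j) + i - j) else 0)"
    unfolding mat_delete_def by (rule eq_matI) (auto simp: A_def)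
  finally show ?thesis by (simp add: jacobi_trudi_det_def A_def)
qed

lemma jacobi_trudi_det_stable:
  assumes "\<And>i. i > N \<Longrightarrow> lam i = 0" "N \<le> M"
  shows "jacobi_trudi_det M lam = jacobi_trudi_det N lam"
  using assms(2)
proof (induction M rule: dec_induct)
  case (step M)
  then show ?case using jacobi_trudi_det_Suc[of lam M] assms(1) by simp
qed simp

lemma alternant_0: "alternant N (\<lambda>_. 0) = (\<Prod>i<N. \<Prod>l\<in>{Suc i..<N}. Var i - Var l)"
  unfolding alternant_def using vandermonde_det[of N Var] by simp

lemma alternant_0_nonzero: "alternant N (\<lambda>_. 0) \<noteq> 0"
  unfolding alternant_0 by simp

lemma alternant_eq_jacobi_trudi_det:
  "alternant N lam = poly_subst (power_sum N) (jacobi_trudi_det N lam) * alternant N (\<lambda>_. 0)"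
proof -
  define h where "h = (\<lambda>n. poly_subst (power_sum N) (complete_q n))"
  have "of_nat (Suc n) * h (Suc n) = (\<Sum>r\<le>n. (\<Sum>l<N. Var l ^ Suc r) * h (n - r))" for n
    using arg_cong[OF complete_q_rec[of n], of "poly_subst (power_sum N)"]
    by (simp add: h_def poly_subst_mult poly_subst_sum power_sum_def poly_subst.hom_of_nat 
        del: of_nat_Suc power_Suc)
  then have "Abs_fps h * (\<Prod>l<N. 1 - fps_const (Var l) * fps_X) = 1"
    by (intro complete_homogeneous_of_power_sums) (auto simp: h_def)
  from jacobi_trudi[OF this, of "\<lambda>j. lam (Suc j)"]
  have "alternant N lam = det (mat N N (\<lambda>(i, j). if j \<le> lam (Suc j) + i then h (lam (Suc j) + i - j) else 0))
      * alternant N (\<lambda>_. 0)"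
    unfolding alternant_def by (simp only: fps_nth_Abs_fps add_0)
  also have "mat N N (\<lambda>(i, j). if j \<le> lam (Suc j) + i then h (lam (Suc j) + i - j) else 0) =
      map_mat (poly_subst (power_sum N))
        (mat N N (\<lambda>(i, j). if j \<le> lam (Suc j) + i then complete_q (lam (Suc j) + i - j) else 0))"
    by (rule eq_matI) (auto simp: h_def)
  finally show ?thesis by (simp add: jacobi_trudi_det_def)
qed

lemma schur_x_eq: "schur_x N lam = poly_subst (power_sum N) (jacobi_trudi_det N lam)"
  unfolding schur_x_def
proof (rule the_equality)
  show "poly_subst (power_sum N) (jacobi_trudi_det N lam) * alternant N (\<lambda>_. 0) = alternant N lam"
    by (simp add: alternant_eq_jacobi_trudi_det[of N lam])
  show "s = poly_subst (power_sum N) (jacobi_trudi_det N lam)" if "s * alternant N (\<lambda>_. 0) = alternant N lam" for s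
    using that alternant_0_nonzero[of N] by (simp add: alternant_eq_jacobi_trudi_det[of N lam])
qed

lemma finite_vars_bound:
  fixes f :: "nat cpoly"
  assumes "poly_vars f \<subseteq> {1..}"
  obtains K where "K \<ge> n" "poly_vars f \<subseteq> {1..K}"
proof
  show "poly_vars f \<subseteq> {1..Max (insert n (poly_vars f))}"
    using assms by (auto intro: Max_ge)
qed simp

lemma schur_eq_jacobi_trudi_det:
  assumes "\<And>i. i > n \<Longrightarrow> lam i = 0"
  shows "schur lam = jacobi_trudi_det n lam"
  unfolding schur_def
proof (rule the_equality)
  have stable: "jacobi_trudi_det N lam = jacobi_trudi_det n lam" if "\<forall>i>N. lam i = 0" for N
    using jacobi_trudi_det_stable[of N lam n] jacobi_trudi_det_stable[of n lam N] that assms by (cases "N \<le> n") auto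
  show "poly_vars (jacobi_trudi_det n lam) \<subseteq> {1..} \<and>
      (\<forall>N. (\<forall>i>N. lam i = 0) \<longrightarrow> poly_subst (power_sum N) (jacobi_trudi_det n lam) = schur_x N lam)"
    using poly_vars_jacobi_trudi_det stable by (simp add: schur_x_eq)
  fix S assume S: "poly_vars S \<subseteq> {1..} \<and>
      (\<forall>N. (\<forall>i>N. lam i = 0) \<longrightarrow> poly_subst (power_sum N) S = schur_x N lam)"
  then have "poly_vars (S - jacobi_trudi_det n lam) \<subseteq> {1..}"
    using poly_vars_jacobi_trudi_det by (intro poly_vars_diff) simp_all
  then obtain N where N: "N \<ge> n" "poly_vars (S - jacobi_trudi_det n lam) \<subseteq> {1..N}"
    by (rule finite_vars_bound)
  have "\<forall>i>N. lam i = 0" using N(1) assms by auto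
  then have "poly_subst (power_sum N) S = poly_subst (power_sum N) (jacobi_trudi_det n lam)"
    using S stable[of N] schur_x_eq[of N lam] by metis
  then have "poly_subst (power_sum N) (S - jacobi_trudi_det n lam) = 0"
    by (simp add: poly_subst.hom_minus)
  then have "S - jacobi_trudi_det n lam = 0" using power_sums_algebraically_independent N(2) by blast
  then show "S = jacobi_trudi_det n lam" by simp
qed

lemma poly_vars_schur:
  assumes "is_partition lam"
  shows "poly_vars (schur lam) \<subseteq> {1..}"
  using assms schur_eq_jacobi_trudi_det[of _ lam] poly_vars_jacobi_trudi_det unfolding is_partition_def by metis

lemma schur_mult_alternant:
  assumes "\<And>i. i > N \<Longrightarrow> lam i = 0"
  shows "alternant N (\<lambda>_. 0) * poly_subst (power_sum N) (schur lam) = alternant N lam"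
  using schur_eq_jacobi_trudi_det[OF assms] by (simp add: alternant_eq_jacobi_trudi_det[of N lam] mult.commute)

lemma partition_antimono:
  assumes "is_partition lam" "1 \<le> i" "i \<le> j"
  shows "lam j \<le> lam i"
  using assms(3)
proof (induction j rule: dec_induct)
  case (step j)
  then show ?case using assms unfolding is_partition_def by (meson le_trans)
qed simp

text \<open>Substituting \<open>x\<^sub>i = 2^(N - 1 - i)\<close> turns the alternant into the transpose of a Vandermonde
  matrix in the numbers \<open>2^(\<lambda>\<^sub>j + N - 1 - j)\<close>, which are distinct because the exponents decrease strictly.\<close>

lemma alternant_nonzero:
  assumes "is_partition lam"
  shows "alternant N lam \<noteq> 0"
proof
  assume 0: "alternant N lam = 0"
  define y where "y = (\<lambda>j. Const (2 ^ (lam (Suc j) + (N - Suc j))) :: nat cpoly)"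
  let ?V = "mat N N (\<lambda>(i, j). y i ^ (N - Suc j))"
  have tr: "transpose_mat ?V = map_mat (poly_subst (\<lambda>i. Const (2 ^ (N - Suc i))))
      (mat N N (\<lambda>(i, j). Var i ^ (lam (Suc j) + (N - Suc j))))"
  proof -
    have "Const (2 ^ a) ^ b = (Const (2 ^ b) ^ a :: nat cpoly)" for a b
      unfolding Const_power[symmetric] power_mult[symmetric] by (simp only: mult.commute)
    then show ?thesis unfolding y_def by (intro eq_matI) (simp_all add: poly_subst.hom_power)
  qed
  have "det ?V = det (transpose_mat ?V)" by (rule det_transpose[symmetric, of _ N]) simp
  also have "\<dots> = poly_subst (\<lambda>i. Const (2 ^ (N - Suc i)) :: nat cpoly) (alternant N lam)"
    unfolding tr alternant_def by (rule poly_subst.hom_det)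
  finally have "(\<Prod>i<N. \<Prod>l\<in>{Suc i..<N}. y i - y l) = 0" using 0 by (simp add: vandermonde_det)
  then obtain i l where il: "i < N" "l \<in> {Suc i..<N}" "y i = y l" by (auto simp: prod_zero_iff)
  then have "lam (Suc l) \<le> lam (Suc i)" by (intro partition_antimono[OF assms]) auto
  then have "lam (Suc l) + (N - Suc l) < lam (Suc i) + (N - Suc i)" using il by auto
  moreover have "lam (Suc l) + (N - Suc l) = lam (Suc i) + (N - Suc i)"
  proof -
    have "(2::complex) ^ (lam (Suc i) + (N - Suc i)) = 2 ^ (lam (Suc l) + (N - Suc l))"
      using il(3) by (simp add: y_def del: power_add)
    then have "of_nat (2 ^ (lam (Suc i) + (N - Suc i))) = (of_nat (2 ^ (lam (Suc l) + (N - Suc l))) :: complex)"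
      by simp
    then show ?thesis unfolding of_nat_eq_iff by simp
  qed
  ultimately show False by simp
qed

lemma schur_nonzero:
  assumes "is_partition lam"
  shows "schur lam \<noteq> 0"
proof
  assume 0: "schur lam = 0"
  obtain n where "\<And>i. i > n \<Longrightarrow> lam i = 0" using assms by (auto simp: is_partition_def)
  then have "alternant n (\<lambda>_. 0) * poly_subst (power_sum n) (schur lam) = alternant n lam"
    by (rule schur_mult_alternant)
  then show False
    using 0 alternant_nonzero[OF assms, of n] by simp
qed

section \<open>The operators \<open>\<theta>\<^sub>i\<close> on alternants\<close>

definition theta :: "nat \<Rightarrow> nat cpoly \<Rightarrow> nat cpoly" where
  "theta i f = Var i * pderiv_var i f"

interpretation theta: derivation "theta i" for i
  unfolding theta_def by (rule pderiv.scale)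

lemma theta_Const [simp]: "theta i (Const c) = 0"
  by (simp add: theta_def)

lemma theta_of_nat [simp]: "theta i (of_nat n) = 0"
  by (simp flip: Const_of_nat)

lemma theta_Var_power: "theta i (Var k ^ n) = (if k = i then of_nat n else 0) * Var k ^ n"
  unfolding theta.power by (cases n) (auto simp: theta_def pderiv_var_Var mult_ac)

text \<open>Each term of the Leibniz formula is a joint eigenvector of the \<open>\<theta>\<^sub>i\<close>, whose eigenvalues are the exponents
  in permuted order. A symmetric function of the \<open>\<theta>\<^sub>i\<close> therefore has the same eigenvalue on all terms.\<close>

lemma theta_power_alternant:
  "(\<Sum>i<N. (theta i ^^ r) (alternant N lam)) =
    of_nat (\<Sum>j<N. (lam (Suc j) + (N - Suc j)) ^ r) * alternant N lam"
proof -
  define mu where "mu = (\<lambda>j. lam (Suc j) + (N - Suc j))"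
  define T :: "(nat \<Rightarrow> nat) \<Rightarrow> nat cpoly" where "T = (\<lambda>p. signof p * (\<Prod>i = 0..<N. Var i ^ mu (p i)))"
  have sg: "signof p = (1 :: nat cpoly) \<or> signof p = (Const (-1) :: nat cpoly)" for p :: "nat \<Rightarrow> nat"
    by (auto simp: sign_def Const_uminus)
  have alt: "alternant N lam = (\<Sum>p\<in>{p. p permutes {0..<N}}. T p)"
    unfolding alternant_def
    by (subst det_def'[of _ N]) (auto intro!: sum.cong prod.cong simp: T_def mu_def dest: permutes_in_image)
  have "theta i (T p) = of_nat (mu (p i)) * T p" if "i < N" for i p
  proof -
    have "theta i (\<Prod>k = 0..<N. Var k ^ mu (p k)) =
        (\<Sum>k = 0..<N. if k = i then of_nat (mu (p k)) else 0) * (\<Prod>k = 0..<N. Var k ^ mu (p k))"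
      by (rule theta.prod_eigen) (rule theta_Var_power)
    moreover have "theta i (signof p) = 0" using sg[of p] by auto
    ultimately show ?thesis using that by (simp add: T_def theta.mult mult_ac)
  qed
  then have "(theta i ^^ r) (T p) = of_nat (mu (p i) ^ r) * T p" if "i < N" for i p
    using that by (induction r) (auto simp: theta.mult mult_ac simp del: of_nat_power)
  moreover have "(theta i ^^ r) (\<Sum>p\<in>A. T p) = (\<Sum>p\<in>A. (theta i ^^ r) (T p))" for A i
    by (induction r) (auto simp: theta.sum)
  ultimately have "(\<Sum>i<N. (theta i ^^ r) (alternant N lam)) =
      (\<Sum>i<N. \<Sum>p\<in>{p. p permutes {0..<N}}. of_nat (mu (p i) ^ r) * T p)"
    unfolding alt by simp
  also have "\<dots> = (\<Sum>p\<in>{p. p permutes {0..<N}}. of_nat (\<Sum>i<N. mu (p i) ^ r) * T p)"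
    by (subst sum.swap) (simp add: sum_distrib_right)
  also have "\<dots> = (\<Sum>p\<in>{p. p permutes {0..<N}}. of_nat (\<Sum>i<N. mu i ^ r) * T p)"
  proof (rule sum.cong[OF refl])
    fix p assume "p \<in> {p. p permutes {0..<N}}"
    then have "(\<Sum>i<N. mu (p i) ^ r) = (\<Sum>i<N. mu i ^ r)"
      using sum.permute[of p "{..<N}" "\<lambda>i. mu i ^ r"] by (simp add: atLeast0LessThan comp_def)
    then show "of_nat (\<Sum>i<N. mu (p i) ^ r) * T p = of_nat (\<Sum>i<N. mu i ^ r) * T p" by simp
  qed
  also have "\<dots> = of_nat (\<Sum>i<N. mu i ^ r) * alternant N lam"
    unfolding alt by (simp add: sum_distrib_left)
  finally show ?thesis by (simp add: mu_def)
qed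

lemma sum_square_symmetric:
  fixes g :: "nat \<Rightarrow> nat \<Rightarrow> 'a::comm_ring_1"
  assumes "\<And>i l. g i l = g l i"
  shows "(\<Sum>i<N. \<Sum>l<N. g i l) = (\<Sum>i<N. g i i) + 2 * (\<Sum>i<N. \<Sum>l\<in>{Suc i..<N}. g i l)"
proof (induction N)
  case (Suc N)
  have "(\<Sum>i<N. \<Sum>l\<in>{Suc i..<Suc N}. g i l) = (\<Sum>i<N. (\<Sum>l\<in>{Suc i..<N}. g i l) + g i N)"
    by (rule sum.cong) auto
  moreover have "(\<Sum>l<N. g N l) = (\<Sum>l<N. g l N)" using assms by (intro sum.cong) auto
  ultimately show ?case using Suc by (simp add: sum.distrib algebra_simps)
qed simp

text \<open>The operator \<open>D = \<Sum> x\<^sub>i\<^sup>k \<theta>\<^sub>i\<close> maps \<open>x\<^sub>i - x\<^sub>l\<close> to \<open>x\<^sub>i\<^sup>k\<^sup>+\<^sup>1 - x\<^sub>l\<^sup>k\<^sup>+\<^sup>1\<close>, a multiple of \<open>x\<^sub>i - x\<^sub>l\<close>. Hence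
  the Vandermonde product is an eigenvector up to a symmetric polynomial factor, the sum of the cofactors
  \<open>\<Sum>\<^sub>r x\<^sub>i\<^sup>r x\<^sub>l\<^sup>k\<^sup>-\<^sup>r\<close> over pairs \<open>i < l\<close>. Doubling it to all ordered pairs produces products of power sums and,
  from the diagonal, the correction \<open>(k + 1) p\<^sub>k\<close>.\<close>

lemma theta_vandermonde:
  "2 * (\<Sum>i<N. Var i ^ k * theta i (alternant N (\<lambda>_. 0))) =
   ((\<Sum>r\<le>k. power_sum N r * power_sum N (k - r)) - of_nat (k + 1) * power_sum N k) * alternant N (\<lambda>_. 0)"
proof -
  define D where "D = (\<lambda>f. \<Sum>i<N. Var i ^ k * theta i f)"
  define g :: "nat \<Rightarrow> nat \<Rightarrow> nat cpoly" where "g = (\<lambda>i l. \<Sum>r<Suc k. Var i ^ r * Var l ^ (k - r))"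
  interpret D: derivation D
    unfolding D_def by (intro derivation_sum theta.scale)
  have DV: "D (Var i) = Var i ^ Suc k" if "i < N" for i
  proof -
    have "D (Var i) = (\<Sum>j<N. if j = i then Var i ^ Suc k else 0)"
      unfolding D_def using theta_Var_power[of _ i 1] by (intro sum.cong) (auto simp: mult.commute)
    then show ?thesis using that by simp
  qed
  have factor: "D (Var i - Var l) = g i l * (Var i - Var l)" if "i < N" "l < N" for i l
  proof -
    have "D (Var i - Var l) = Var i ^ Suc k - Var l ^ Suc k" using that by (simp only: D.minus DV)
    also have "\<dots> = (Var i - Var l) * g i l" unfolding g_def by (rule diff_power_eq_sum)
    finally show ?thesis by (simp only: mult.commute)
  qed
  have inner: "D (\<Prod>l\<in>{Suc i..<N}. Var i - Var l) = (\<Sum>l\<in>{Suc i..<N}. g i l) * (\<Prod>l\<in>{Suc i..<N}. Var i - Var l)" if "i < N" for i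
    using that by (intro D.prod_eigen factor) auto
  have D0: "D (alternant N (\<lambda>_. 0)) = (\<Sum>i<N. \<Sum>l\<in>{Suc i..<N}. g i l) * alternant N (\<lambda>_. 0)"
    unfolding alternant_0 by (rule D.prod_eigen) (simp add: inner)
  have "g i l = g l i" for i l
    unfolding g_def by (subst sum.nat_diff_reindex[symmetric]) (auto intro!: sum.cong simp: mult.commute)
  note S = sum_square_symmetric[of g N, OF this]
  have "(\<Sum>i<N. \<Sum>l<N. g i l) = (\<Sum>r\<le>k. power_sum N r * power_sum N (k - r))"
  proof -
    have "(\<Sum>i<N. \<Sum>l<N. g i l) = (\<Sum>i<N. \<Sum>r<Suc k. \<Sum>l<N. Var i ^ r * Var l ^ (k - r))"
      unfolding g_def by (intro sum.cong refl sum.swap)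
    also have "\<dots> = (\<Sum>r<Suc k. \<Sum>i<N. \<Sum>l<N. Var i ^ r * Var l ^ (k - r))"
      by (rule sum.swap)
    finally show ?thesis by (simp add: power_sum_def sum_product lessThan_Suc_atMost)
  qed
  moreover have "(\<Sum>i<N. g i i) = of_nat (k + 1) * power_sum N k"
  proof -
    have "g i i = of_nat (k + 1) * Var i ^ k" for i
    proof -
      have "g i i = (\<Sum>r<Suc k. Var i ^ k)"
        unfolding g_def by (intro sum.cong) (auto simp flip: power_add)
      then show ?thesis by simp
    qed
    then show ?thesis by (simp add: power_sum_def sum_distrib_left)
  qed
  ultimately have "2 * (\<Sum>i<N. \<Sum>l\<in>{Suc i..<N}. g i l) =
      (\<Sum>r\<le>k. power_sum N r * power_sum N (k - r)) - of_nat (k + 1) * power_sum N k"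
    using S by (simp add: algebra_simps)
  moreover have "2 * D (alternant N (\<lambda>_. 0)) = (2 * (\<Sum>i<N. \<Sum>l\<in>{Suc i..<N}. g i l)) * alternant N (\<lambda>_. 0)"
    unfolding D0 by (simp only: mult.assoc)
  ultimately show ?thesis unfolding D_def by (simp only:)
qed

section \<open>Euler and cut-and-join operators in one alphabet\<close>

text \<open>Both operators are truncated at \<open>K\<close>; on polynomials in \<open>q\<^sub>1, \<dots>, q\<^sub>K\<close> nothing is lost.\<close>

definition euler :: "nat \<Rightarrow> nat cpoly \<Rightarrow> nat cpoly" where
  "euler K f = (\<Sum>k\<in>{1..K}. of_nat k * Var k * pderiv_var k f)"

text \<open>Twice the usual operator. The first sum is indexed by \<open>k = i + j\<close>, as it arises from the
  Vandermonde determinant.\<close>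

definition cut_join :: "nat \<Rightarrow> nat cpoly \<Rightarrow> nat cpoly" where
  "cut_join K f = (\<Sum>k\<in>{1..K}. \<Sum>r\<in>{1..<k}. of_nat k * Var r * Var (k - r) * pderiv_var k f)
     + (\<Sum>i\<in>{1..K}. \<Sum>j\<in>{1..K}. of_nat (i * j) * Var (i + j) * pderiv_var i (pderiv_var j f))"

lemma theta_power_sum: "i < N \<Longrightarrow> theta i (power_sum N k) = of_nat k * Var i ^ k"
proof -
  assume "i < N"
  have "theta i (power_sum N k) = (\<Sum>j<N. if j = i then of_nat k * Var i ^ k else 0)"
    unfolding power_sum_def theta.sum theta_Var_power by (intro sum.cong) auto
  then show ?thesis using \<open>i < N\<close> by simp
qed

lemma theta_subst:
  assumes "poly_vars f \<subseteq> {1..K}" "i < N"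
  shows "theta i (poly_subst (power_sum N) f) =
    (\<Sum>k\<in>{1..K}. of_nat k * Var i ^ k * poly_subst (power_sum N) (pderiv_var k f))"
proof -
  have "theta i (poly_subst (power_sum N) f) =
      (\<Sum>k\<in>{1..K}. poly_subst (power_sum N) (pderiv_var k f) * theta i (power_sum N k))"
    using assms by (intro chain_rule theta.derivation_axioms) auto
  then show ?thesis using assms(2) by (simp add: theta_power_sum mult_ac)
qed

lemma sum_theta_subst:
  assumes "poly_vars f \<subseteq> {1..K}"
  shows "(\<Sum>i<N. theta i (poly_subst (power_sum N) f)) = poly_subst (power_sum N) (euler K f)"
proof -
  have "(\<Sum>i<N. theta i (poly_subst (power_sum N) f)) =
      (\<Sum>i<N. \<Sum>k\<in>{1..K}. of_nat k * Var i ^ k * poly_subst (power_sum N) (pderiv_var k f))"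
    using theta_subst[OF assms] by simp
  also have "\<dots> = (\<Sum>k\<in>{1..K}. of_nat k * power_sum N k * poly_subst (power_sum N) (pderiv_var k f))"
    by (subst sum.swap) (simp add: power_sum_def sum_distrib_left sum_distrib_right mult.assoc)
  finally show ?thesis
    by (simp add: euler_def poly_subst.hom_sum poly_subst_mult poly_subst.hom_of_nat)
qed

lemma sum_theta_theta_subst:
  assumes "poly_vars f \<subseteq> {1..K}"
  shows "(\<Sum>i<N. theta i (theta i (poly_subst (power_sum N) f))) =
    poly_subst (power_sum N) ((\<Sum>k\<in>{1..K}. of_nat (k * k) * Var k * pderiv_var k f)
     + (\<Sum>i\<in>{1..K}. \<Sum>j\<in>{1..K}. of_nat (i * j) * Var (i + j) * pderiv_var i (pderiv_var j f)))"
proof -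
  let ?\<phi> = "poly_subst (power_sum N)"
  have "theta i (theta i (?\<phi> f)) = (\<Sum>k\<in>{1..K}. of_nat (k * k) * Var i ^ k * ?\<phi> (pderiv_var k f))
     + (\<Sum>j\<in>{1..K}. \<Sum>l\<in>{1..K}. of_nat (l * j) * Var i ^ (l + j) * ?\<phi> (pderiv_var l (pderiv_var j f)))"
    if i: "i < N" for i
  proof -
    have "theta i (theta i (?\<phi> f)) = (\<Sum>j\<in>{1..K}. theta i (of_nat j * Var i ^ j * ?\<phi> (pderiv_var j f)))"
      by (simp add: theta_subst[OF assms i] theta.sum)
    also have "\<dots> = (\<Sum>j\<in>{1..K}. of_nat (j * j) * Var i ^ j * ?\<phi> (pderiv_var j f)
      + (\<Sum>l\<in>{1..K}. of_nat (l * j) * Var i ^ (l + j) * ?\<phi> (pderiv_var l (pderiv_var j f))))"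
    proof (rule sum.cong[OF refl])
      fix j
      have "theta i (of_nat j * Var i ^ j * ?\<phi> (pderiv_var j f)) =
        of_nat j * (of_nat j * Var i ^ j) * ?\<phi> (pderiv_var j f)
        + of_nat j * Var i ^ j * theta i (?\<phi> (pderiv_var j f))"
        by (simp add: theta.mult theta_of_nat theta_Var_power)
      also have "theta i (?\<phi> (pderiv_var j f)) =
        (\<Sum>l\<in>{1..K}. of_nat l * Var i ^ l * ?\<phi> (pderiv_var l (pderiv_var j f)))"
        by (rule theta_subst[OF poly_vars_pderiv[OF assms] i])
      finally show "theta i (of_nat j * Var i ^ j * ?\<phi> (pderiv_var j f)) =
        of_nat (j * j) * Var i ^ j * ?\<phi> (pderiv_var j f)
        + (\<Sum>l\<in>{1..K}. of_nat (l * j) * Var i ^ (l + j) * ?\<phi> (pderiv_var l (pderiv_var j f)))"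
        by (simp add: sum_distrib_left power_add mult_ac)
    qed
    finally show ?thesis by (simp add: sum.distrib)
  qed
  then have "(\<Sum>i<N. theta i (theta i (?\<phi> f))) =
     (\<Sum>i<N. \<Sum>k\<in>{1..K}. of_nat (k * k) * Var i ^ k * ?\<phi> (pderiv_var k f))
     + (\<Sum>i<N. \<Sum>j\<in>{1..K}. \<Sum>l\<in>{1..K}. of_nat (l * j) * Var i ^ (l + j) * ?\<phi> (pderiv_var l (pderiv_var j f)))"
    by (simp add: sum.distrib)
  also have "(\<Sum>i<N. \<Sum>k\<in>{1..K}. of_nat (k * k) * Var i ^ k * ?\<phi> (pderiv_var k f)) =
      (\<Sum>k\<in>{1..K}. of_nat (k * k) * power_sum N k * ?\<phi> (pderiv_var k f))"
    by (subst sum.swap) (simp add: power_sum_def sum_distrib_left sum_distrib_right mult.assoc)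
  also have "(\<Sum>i<N. \<Sum>j\<in>{1..K}. \<Sum>l\<in>{1..K}. of_nat (l * j) * Var i ^ (l + j) * ?\<phi> (pderiv_var l (pderiv_var j f))) =
      (\<Sum>j\<in>{1..K}. \<Sum>i<N. \<Sum>l\<in>{1..K}. of_nat (l * j) * Var i ^ (l + j) * ?\<phi> (pderiv_var l (pderiv_var j f)))"
    by (rule sum.swap)
  also have "\<dots> = (\<Sum>j\<in>{1..K}. \<Sum>l\<in>{1..K}. of_nat (l * j) * power_sum N (l + j) * ?\<phi> (pderiv_var l (pderiv_var j f)))"
    by (rule sum.cong[OF refl], subst sum.swap)
      (simp add: power_sum_def sum_distrib_left sum_distrib_right mult.assoc)
  also have "\<dots> = (\<Sum>l\<in>{1..K}. \<Sum>j\<in>{1..K}. of_nat (l * j) * power_sum N (l + j) * ?\<phi> (pderiv_var l (pderiv_var j f)))"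
    by (rule sum.swap)
  finally show ?thesis
    by (simp add: poly_subst_add poly_subst.hom_sum poly_subst_mult poly_subst.hom_of_nat del: of_nat_mult)
qed

text \<open>By the Leibniz rule, \<open>\<Sum>\<theta>\<^sub>i\<^sup>2 (a \<phi> f)\<close> has three parts. The square on \<open>a\<close> gives the constant, the
  square on \<open>\<phi> f\<close> gives the second-order (cut) terms and \<open>\<Sum> k\<^sup>2 q\<^sub>k \<partial>\<^sub>k\<close>, and the mixed part gives the join terms together with
  \<open>\<Sum> k (2 N - k - 1) q\<^sub>k \<partial>\<^sub>k\<close>. The two diagonal sums combine to \<open>2 N - 1\<close> times the Euler operator.\<close>

lemma sum_theta_theta_vandermonde_mult:
  fixes N :: nat
  assumes f: "poly_vars f \<subseteq> {1..K}"
  defines "a \<equiv> alternant N (\<lambda>_. 0)" and "\<phi> \<equiv> poly_subst (power_sum N)"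
  shows "(\<Sum>i<N. theta i (theta i (a * \<phi> f))) =
     a * (of_nat (\<Sum>j<N. (N - Suc j)\<^sup>2) * \<phi> f + \<phi> (cut_join K f) + (2 * of_nat N - 1) * \<phi> (euler K f))"
proof -
  \<comment> \<open>The final bookkeeping, for arbitrary elements so that the sums stay opaque.\<close>
  have combine: "X = a * (d * F + C + E)"
    if "X = A * F + W + a * Y" "A = d * a" "W = a * (R + M)" "Y = Z + Q" "C = R + Q" "M + Z = E"
    for A C E F M Q R W X Y Z d :: "nat cpoly"
    unfolding that(1-5) that(6)[symmetric] by (simp add: algebra_simps)
  have "(\<Sum>i<N. theta i (theta i (a * \<phi> f))) =
      (\<Sum>i<N. theta i (theta i a)) * \<phi> f + 2 * (\<Sum>i<N. theta i a * theta i (\<phi> f))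
      + a * (\<Sum>i<N. theta i (theta i (\<phi> f)))"
    by (simp add: theta.mult theta.add sum.distrib sum_distrib_left sum_distrib_right algebra_simps)
  moreover have "(\<Sum>i<N. theta i (theta i a)) = of_nat (\<Sum>j<N. (N - Suc j)\<^sup>2) * a"
    using theta_power_alternant[where r = 2 and N = N and lam = "\<lambda>_. 0"]
    by (simp add: a_def numeral_2_eq_2)
  moreover have "2 * (\<Sum>i<N. theta i a * theta i (\<phi> f)) =
      a * ((\<Sum>k\<in>{1..K}. \<Sum>r\<in>{1..<k}. of_nat k * power_sum N r * power_sum N (k - r) * \<phi> (pderiv_var k f))
        + (\<Sum>k\<in>{1..K}. of_nat k * (2 * of_nat N - of_nat (k + 1)) * power_sum N k * \<phi> (pderiv_var k f)))"
  proof -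
    have "2 * (\<Sum>i<N. theta i a * theta i (\<phi> f)) =
        2 * (\<Sum>i<N. \<Sum>k\<in>{1..K}. of_nat k * \<phi> (pderiv_var k f) * (Var i ^ k * theta i a))"
      using theta_subst[OF f] by (simp add: \<phi>_def sum_distrib_left mult_ac)
    also have "\<dots> = (\<Sum>k\<in>{1..K}. of_nat k * \<phi> (pderiv_var k f) * (2 * (\<Sum>i<N. Var i ^ k * theta i a)))"
      by (subst sum.swap) (simp add: sum_distrib_left mult_ac)
    also have "\<dots> = (\<Sum>k\<in>{1..K}. a * ((\<Sum>r\<in>{1..<k}. of_nat k * power_sum N r * power_sum N (k - r) * \<phi> (pderiv_var k f))
        + of_nat k * (2 * of_nat N - of_nat (k + 1)) * power_sum N k * \<phi> (pderiv_var k f)))"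
    proof (rule sum.cong[OF refl])
      fix k assume "k \<in> {1..K}"
      then obtain k' where k': "k = Suc k'" by (cases k) auto
      have p0: "power_sum N 0 = of_nat N" by (simp add: power_sum_def)
      \<comment> \<open>The terms \<open>r = 0\<close> and \<open>r = k\<close> contain \<open>p\<^sub>0 = N\<close>; they are the source of the dependence on \<open>N\<close>.\<close>
      have "{..k} = insert 0 (insert k {1..<k})" using k' by auto
      then have split: "(\<Sum>r\<le>k. power_sum N r * power_sum N (k - r)) =
          (\<Sum>r\<in>{1..<k}. power_sum N r * power_sum N (k - r)) + 2 * of_nat N * power_sum N k"
        using k' by (simp add: p0 algebra_simps)
      have "(2 * (\<Sum>i<N. Var i ^ k * theta i a)) =
        a * ((\<Sum>r\<in>{1..<k}. power_sum N r * power_sum N (k - r)) + (2 * of_nat N - of_nat (k + 1)) * power_sum N k)"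
        unfolding a_def theta_vandermonde split by (simp add: algebra_simps)
      then have "of_nat k * \<phi> (pderiv_var k f) * (2 * (\<Sum>i<N. Var i ^ k * theta i a)) =
        a * ((\<Sum>r\<in>{1..<k}. power_sum N r * power_sum N (k - r)) * (of_nat k * \<phi> (pderiv_var k f))
           + of_nat k * (2 * of_nat N - of_nat (k + 1)) * power_sum N k * \<phi> (pderiv_var k f))"
        by (simp only:) (simp add: algebra_simps)
      then show "of_nat k * \<phi> (pderiv_var k f) * (2 * (\<Sum>i<N. Var i ^ k * theta i a)) =
        a * ((\<Sum>r\<in>{1..<k}. of_nat k * power_sum N r * power_sum N (k - r) * \<phi> (pderiv_var k f))
        + of_nat k * (2 * of_nat N - of_nat (k + 1)) * power_sum N k * \<phi> (pderiv_var k f))"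
        by (simp only: sum_distrib_right) (simp only: mult_ac)
    qed
    finally show ?thesis by (simp only: sum_distrib_left sum.distrib distrib_left)
  qed
  moreover have "(\<Sum>i<N. theta i (theta i (\<phi> f))) =
      (\<Sum>k\<in>{1..K}. of_nat (k * k) * power_sum N k * \<phi> (pderiv_var k f))
      + \<phi> (\<Sum>i\<in>{1..K}. \<Sum>j\<in>{1..K}. of_nat (i * j) * Var (i + j) * pderiv_var i (pderiv_var j f))"
    unfolding \<phi>_def sum_theta_theta_subst[OF f]
    by (simp add: poly_subst_add poly_subst.hom_sum poly_subst_mult poly_subst.hom_of_nat del: of_nat_mult)
  moreover have "\<phi> (cut_join K f) =
      (\<Sum>k\<in>{1..K}. \<Sum>r\<in>{1..<k}. of_nat k * power_sum N r * power_sum N (k - r) * \<phi> (pderiv_var k f))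
      + \<phi> (\<Sum>i\<in>{1..K}. \<Sum>j\<in>{1..K}. of_nat (i * j) * Var (i + j) * pderiv_var i (pderiv_var j f))"
    unfolding cut_join_def \<phi>_def
    by (simp add: poly_subst_add poly_subst.hom_sum poly_subst_mult poly_subst.hom_of_nat del: of_nat_mult)
  moreover have "(\<Sum>k\<in>{1..K}. of_nat k * (2 * of_nat N - of_nat (k + 1)) * power_sum N k * \<phi> (pderiv_var k f))
      + (\<Sum>k\<in>{1..K}. of_nat (k * k) * power_sum N k * \<phi> (pderiv_var k f))
      = (2 * of_nat N - 1) * \<phi> (euler K f)"
    unfolding euler_def \<phi>_def
    by (simp add: poly_subst.hom_sum poly_subst_mult poly_subst.hom_of_nat sum_distrib_left
        algebra_simps flip: sum.distrib)
  ultimately show ?thesis by (rule combine)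
qed

lemma eq_0_if_all_power_sum_images_0:
  assumes "poly_vars f \<subseteq> {1..}" "\<And>N. N \<ge> n \<Longrightarrow> poly_subst (power_sum N) f = 0"
  shows "f = 0"
proof -
  obtain N where "N \<ge> n" "poly_vars f \<subseteq> {1..N}"
    using assms(1) by (rule finite_vars_bound)
  then show ?thesis using assms(2) power_sums_algebraically_independent by blast
qed

lemma sum_partition_shift:
  fixes h :: "nat \<Rightarrow> 'a::comm_monoid_add"
  assumes "\<And>i. i > n \<Longrightarrow> h i = 0" "N \<ge> n"
  shows "(\<Sum>j<N. h (Suc j)) = (\<Sum>i=1..n. h i)"
proof -
  have "(\<Sum>j<N. h (Suc j)) = (\<Sum>i=1..N. h i)"
    by (simp add: sum.atLeast1_atMost_eq)
  also have "\<dots> = (\<Sum>i=1..n. h i)"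
    using assms by (intro sum.mono_neutral_right) auto
  finally show ?thesis .
qed

text \<open>Multiplied by the Vandermonde determinant, the Schur polynomial becomes an alternant, whose
  degree exceeds that of the Vandermonde determinant by the size of the partition.\<close>

lemma euler_schur:
  assumes lam: "is_partition lam" and n: "\<And>i. i > n \<Longrightarrow> lam i = 0"
    and K: "poly_vars (schur lam) \<subseteq> {1..K}"
  shows "euler K (schur lam) = Const (\<Sum>i=1..n. of_nat (lam i)) * schur lam"
proof -
  let ?f = "euler K (schur lam) - Const (\<Sum>i=1..n. of_nat (lam i)) * schur lam"
  have "?f = 0"
  proof (rule eq_0_if_all_power_sum_images_0)
    show "poly_vars ?f \<subseteq> {1..}"
      unfolding euler_def using poly_vars_schur[OF lam]
      by (intro poly_vars_diff poly_vars_sum poly_vars_mult poly_vars_pderiv) auto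
  next
    fix N assume N: "N \<ge> n"
    let ?a = "alternant N (\<lambda>_. 0)" and ?\<phi> = "poly_subst (power_sum N)"
    have "?a * ?\<phi> (schur lam) = alternant N lam"
      using N n by (intro schur_mult_alternant) auto
    then have "of_nat (\<Sum>j<N. lam (Suc j) + (N - Suc j)) * (?a * ?\<phi> (schur lam)) =
        (\<Sum>i<N. theta i (?a * ?\<phi> (schur lam)))"
      using theta_power_alternant[where r = 1 and N = N and lam = lam] by simp
    also have "\<dots> = (\<Sum>i<N. theta i ?a) * ?\<phi> (schur lam) + ?a * ?\<phi> (euler K (schur lam))"
      by (simp add: theta.mult sum.distrib sum_distrib_left sum_distrib_right flip: sum_theta_subst[OF K])
    also have "(\<Sum>i<N. theta i ?a) = of_nat (\<Sum>j<N. N - Suc j) * ?a"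
      using theta_power_alternant[where r = 1 and N = N and lam = "\<lambda>_. 0"] by simp
    finally have "?a * ?\<phi> (euler K (schur lam)) = ?a * (of_nat (\<Sum>j<N. lam (Suc j)) * ?\<phi> (schur lam))"
      unfolding sum.distrib of_nat_add by (simp only: algebra_simps add_right_cancel eq_commute)
    then have "?\<phi> (euler K (schur lam)) = of_nat (\<Sum>j<N. lam (Suc j)) * ?\<phi> (schur lam)"
      using alternant_0_nonzero[of N] by simp
    moreover have "(\<Sum>j<N. lam (Suc j)) = (\<Sum>i=1..n. lam i)"
      using n N by (intro sum_partition_shift) auto
    ultimately have "?\<phi> (euler K (schur lam)) = Const (\<Sum>i=1..n. of_nat (lam i)) * ?\<phi> (schur lam)"
      by (simp only: Const_of_nat of_nat_sum Const_sum)
    then show "?\<phi> ?f = 0"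
      by (simp only: poly_subst.hom_minus poly_subst_mult poly_subst_Const diff_self)
  qed
  then show ?thesis by simp
qed

text \<open>The two expressions for \<open>\<Sum>\<theta>\<^sub>i\<^sup>2\<close> on the alternant give the eigenvalue
  \<open>\<Sum> (\<lambda>\<^sub>j + N - j)\<^sup>2 - \<Sum> (N - j)\<^sup>2 - (2 N - 1) \<Sum> \<lambda>\<^sub>j\<close>, in which \<open>N\<close> cancels.\<close>

lemma cut_join_schur:
  assumes lam: "is_partition lam" and n: "\<And>i. i > n \<Longrightarrow> lam i = 0"
    and K: "poly_vars (schur lam) \<subseteq> {1..K}"
  shows "cut_join K (schur lam) =
    Const (\<Sum>i=1..n. of_nat (lam i) * (of_nat (lam i) - 2 * of_nat i + 1)) * schur lam"
proof -
  let ?c = "\<Sum>i=1..n. of_nat (lam i) * (of_nat (lam i) - 2 * of_nat i + 1) :: complex"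
  let ?f = "cut_join K (schur lam) - Const ?c * schur lam"
  have cancel: "C = (m - d - e * s) * F"
    if "m * (a * F) = a * (d * F + C + e * (s * F))" "a \<noteq> 0" for C F a d e m s :: "nat cpoly"
  proof -
    have "a * C = a * ((m - d - e * s) * F)" using that(1) by (simp add: algebra_simps)
    then show ?thesis using that(2) by simp
  qed
  have "?f = 0"
  proof (rule eq_0_if_all_power_sum_images_0)
    show "poly_vars ?f \<subseteq> {1..}"
      unfolding cut_join_def using poly_vars_schur[OF lam]
      by (intro poly_vars_diff poly_vars_add poly_vars_sum poly_vars_mult poly_vars_pderiv)
        (auto simp del: of_nat_mult)
  next
    fix N assume N: "N \<ge> n"
    let ?a = "alternant N (\<lambda>_. 0)" and ?\<phi> = "poly_subst (power_sum N)"
    let ?mu = "\<Sum>j<N. (lam (Suc j) + (N - Suc j))\<^sup>2" and ?delta = "\<Sum>j<N. (N - Suc j)\<^sup>2"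
    let ?size = "\<Sum>i=1..n. of_nat (lam i) :: complex"
    have "?a * ?\<phi> (schur lam) = alternant N lam"
      using N n by (intro schur_mult_alternant) auto
    then have "of_nat ?mu * (?a * ?\<phi> (schur lam)) = (\<Sum>i<N. theta i (theta i (?a * ?\<phi> (schur lam))))"
      using theta_power_alternant[where r = 2 and N = N and lam = lam] by (simp add: numeral_2_eq_2)
    also have "\<dots> = ?a * (of_nat ?delta * ?\<phi> (schur lam) + ?\<phi> (cut_join K (schur lam))
        + (2 * of_nat N - 1) * ?\<phi> (euler K (schur lam)))"
      by (rule sum_theta_theta_vandermonde_mult[OF K])
    also have "euler K (schur lam) = Const ?size * schur lam"
      using lam n K by (rule euler_schur)
    also have "?\<phi> (Const ?size * schur lam) = Const ?size * ?\<phi> (schur lam)"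
      by (simp only: poly_subst_mult poly_subst_Const)
    finally have "?\<phi> (cut_join K (schur lam)) =
        (of_nat ?mu - of_nat ?delta - (2 * of_nat N - 1) * Const ?size) * ?\<phi> (schur lam)"
      using alternant_0_nonzero[of N] by (rule cancel)
    moreover have "of_nat ?mu - of_nat ?delta - (2 * of_nat N - 1) * Const ?size = (Const ?c :: nat cpoly)"
    proof -
      have two: "(2 * of_nat N - 1 :: nat cpoly) = Const (2 * of_nat N - 1)"
        by (simp add: Const_diff Const_mult Const_of_nat Const_of_nat[of 2, simplified])
      have "of_nat ?mu - of_nat ?delta - (2 * of_nat N - 1) * Const ?size =
          (Const (of_nat ?mu - of_nat ?delta - (2 * of_nat N - 1) * ?size) :: nat cpoly)"
        unfolding two
        by (simp only: Const_diff[of "of_nat ?mu"] Const_diff[of "of_nat ?mu - of_nat ?delta"]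
            Const_mult[of "2 * of_nat N - 1"] Const_of_nat)
      also have "of_nat ?mu - of_nat ?delta - (2 * of_nat N - 1) * ?size = ?c"
      proof -
        have "?size = (\<Sum>j<N. of_nat (lam (Suc j)))"
          using n N by (intro sum_partition_shift[symmetric]) auto
        then have "of_nat ?mu - of_nat ?delta - (2 * of_nat N - 1) * ?size =
            (\<Sum>j<N. of_nat ((lam (Suc j) + (N - Suc j))\<^sup>2) - of_nat ((N - Suc j)\<^sup>2) - (2 * of_nat N - 1) * of_nat (lam (Suc j)))"
          by (simp only: of_nat_sum sum_subtractf sum_distrib_left)
        also have "\<dots> = (\<Sum>j<N. of_nat (lam (Suc j)) * (of_nat (lam (Suc j)) - 2 * of_nat (Suc j) + 1))"
        proof (rule sum.cong[OF refl])
          fix j assume "j \<in> {..<N}"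
          then have "of_nat (N - Suc j) = (of_nat N - of_nat (Suc j) :: complex)" by (simp add: of_nat_diff)
          then show "of_nat ((lam (Suc j) + (N - Suc j))\<^sup>2) - of_nat ((N - Suc j)\<^sup>2) - (2 * of_nat N - 1) * of_nat (lam (Suc j)) =
            (of_nat (lam (Suc j)) * (of_nat (lam (Suc j)) - 2 * of_nat (Suc j) + 1) :: complex)"
            by (simp only: of_nat_power of_nat_add) (simp add: power2_eq_square algebra_simps)
        qed
        also have "\<dots> = ?c"
          using n N by (intro sum_partition_shift) auto
        finally show ?thesis .
      qed
      finally show ?thesis .
    qed
    ultimately show "?\<phi> ?f = 0"
      by (simp only: poly_subst.hom_minus poly_subst_mult poly_subst_Const diff_self)
  qed
  then show ?thesis by simp
qed

section \<open>Roots of unity\<close>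

lemma xi_eq_cis: "\<xi> m = cis (2 * pi / real m)"
  by (simp add: \<xi>_def cis_conv_exp mult_ac)

lemma xi_nonzero [simp]: "\<xi> m \<noteq> 0"
  by (simp add: \<xi>_def)

lemma xi_power_m [simp]: "m > 0 \<Longrightarrow> \<xi> m ^ m = 1"
  by (simp add: xi_eq_cis DeMoivre)

lemma xi_power_mod: "m > 0 \<Longrightarrow> \<xi> m ^ (b * (n mod m)) = \<xi> m ^ (b * n)"
proof -
  assume m: "m > 0"
  have "\<xi> m ^ n = \<xi> m ^ (m * (n div m) + n mod m)" by simp
  also have "\<dots> = \<xi> m ^ (n mod m)" using m by (simp only: power_add power_mult xi_power_m) simp
  finally show ?thesis by (simp add: mult.commute[of b] power_mult)
qed

lemma xi_power_inj:
  assumes "a < m" "b < m" "\<xi> m ^ a = \<xi> m ^ b"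
  shows "a = b"
proof -
  have cis: "cis (2 * pi * real k / real m) = \<xi> m ^ k" for k
    by (simp add: xi_eq_cis DeMoivre mult_ac)
  have "inj_on (\<lambda>k. cis (2 * pi * real k / real m)) {..<m}"
    using bij_betw_roots_unity[of m] assms(1) by (auto simp: bij_betw_def)
  then show ?thesis using assms by (auto simp: cis inj_on_def)
qed

lemma xi_orthogonal:
  assumes "a < m" "b < m"
  shows "(\<Sum>\<alpha><m. \<xi> m ^ (a * \<alpha>) * inverse (\<xi> m) ^ (b * \<alpha>)) = (if a = b then of_nat m else 0)"
proof -
  define z where "z = \<xi> m ^ a * inverse (\<xi> m) ^ b"
  have sum: "(\<Sum>\<alpha><m. \<xi> m ^ (a * \<alpha>) * inverse (\<xi> m) ^ (b * \<alpha>)) = (\<Sum>\<alpha><m. z ^ \<alpha>)"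
    by (simp add: z_def power_mult_distrib power_mult)
  show ?thesis
  proof (cases "a = b")
    case True
    then show ?thesis unfolding sum by (simp add: z_def flip: power_mult_distrib)
  next
    case False
    have "z \<noteq> 1"
    proof
      assume "z = 1"
      then have "\<xi> m ^ a = \<xi> m ^ b" by (simp add: z_def field_simps)
      then show False using xi_power_inj assms False by blast
    qed
    moreover have "z ^ m = 1"
    proof -
      have "z ^ m = (\<xi> m ^ m) ^ a * inverse ((\<xi> m ^ m) ^ b)"
        by (simp add: z_def power_mult_distrib power_inverse mult.commute flip: power_mult)
      then show ?thesis using assms by simp
    qed
    ultimately show ?thesis unfolding sum using False by (simp add: geometric_sum)
  qed
qed

lemma sum_mod_shift:
  fixes h :: "nat \<Rightarrow> 'a::comm_monoid_add"
  assumes "m > 0"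
  shows "(\<Sum>\<alpha><m. h ((\<alpha> + k) mod m)) = (\<Sum>\<alpha><m. h \<alpha>)"
proof -
  have "inj_on (\<lambda>\<alpha>. (\<alpha> + k) mod m) {..<m}"
  proof (rule linorder_inj_onI)
    fix x y assume xy: "x < y" "x \<in> {..<m}" "y \<in> {..<m}"
    have "\<not> m dvd y - x" using xy by (auto dest: dvd_imp_le)
    then show "(x + k) mod m \<noteq> (y + k) mod m"
      using mod_eq_dvd_iff_nat[of "x + k" "y + k" m] xy by auto
  qed auto
  then have "bij_betw (\<lambda>\<alpha>. (\<alpha> + k) mod m) {..<m} {..<m}"
    using assms by (intro bij_betw_imageI endo_inj_surj) auto
  then show ?thesis by (rule sum.reindex_bij_betw)
qed

section \<open>Diagonalising the coloured operators\<close>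

text \<open>A pair \<open>(a, i)\<close> names the indeterminate \<open>P\<^sup>a\<^sub>i\<close> in the argument, but \<open>p\<^sup>a\<^sub>i\<close> in the value; the first is
  expressed here through the second.\<close>

definition uncolor :: "nat \<Rightarrow> (nat \<times> nat) cpoly \<Rightarrow> (nat \<times> nat) cpoly" where
  "uncolor m = poly_subst (\<lambda>(\<alpha>, i). colored_var m \<alpha> i)"

lemma uncolor_Var [simp]: "uncolor m (Var (\<alpha>, i)) = colored_var m \<alpha> i"
  and uncolor_Const [simp]: "uncolor m (Const c) = Const c"
  and uncolor_of_nat [simp]: "uncolor m (of_nat n) = of_nat n"
  and uncolor_add: "uncolor m (f + g) = uncolor m f + uncolor m g"
  and uncolor_mult: "uncolor m (f * g) = uncolor m f * uncolor m g"
  and uncolor_sum: "uncolor m (sum h A) = (\<Sum>x\<in>A. uncolor m (h x))"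
  by (simp_all add: uncolor_def poly_subst_add poly_subst_mult poly_subst_sum poly_subst.hom_of_nat)

lemma pderiv_colored_var:
  assumes "\<beta> < m"
  shows "pderiv_var (\<beta>, i) (colored_var m \<alpha> k) = (if k = i then Const (\<xi> m ^ (\<alpha> * \<beta>) / of_nat m) else 0)"
proof -
  have "pderiv_var (\<beta>, i) (colored_var m \<alpha> k) =
      (\<Sum>\<gamma><m. if \<gamma> = \<beta> then (if k = i then Const (\<xi> m ^ (\<alpha> * \<beta>) / of_nat m) else 0) else 0)"
    unfolding colored_var_def pderiv.sum
    by (intro sum.cong) (auto simp: pderiv_var_Const_mult pderiv_var_Var)
  then show ?thesis using assms by simp
qed

text \<open>The colour \<open>\<beta>\<close> occurs in every \<open>P\<^sup>a\<^sub>i\<close>, with coefficient \<open>\<xi>\<^sup>a\<^sup>\<beta> / m\<close>.\<close>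

lemma pderiv_uncolor:
  assumes "poly_vars F \<subseteq> {..<m} \<times> {1..K}" "\<beta> < m"
  shows "pderiv_var (\<beta>, i) (uncolor m F) =
    (\<Sum>a<m. Const (\<xi> m ^ (a * \<beta>) / of_nat m) * uncolor m (pderiv_var (a, i) F))"
proof -
  let ?V = "{..<m} \<times> insert i {1..K}"
  have "pderiv_var (\<beta>, i) (uncolor m F) =
      (\<Sum>v\<in>?V. uncolor m (pderiv_var v F) * pderiv_var (\<beta>, i) (case v of (\<alpha>, k) \<Rightarrow> colored_var m \<alpha> k))"
    unfolding uncolor_def using assms(1) by (intro chain_rule pderiv.derivation_axioms) auto
  also have "\<dots> = (\<Sum>a<m. \<Sum>k\<in>insert i {1..K}. uncolor m (pderiv_var (a, k) F) * pderiv_var (\<beta>, i) (colored_var m a k))"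
    unfolding sum.cartesian_product by (intro sum.cong) auto
  also have "\<dots> = (\<Sum>a<m. \<Sum>k\<in>insert i {1..K}. if k = i then Const (\<xi> m ^ (a * \<beta>) / of_nat m) * uncolor m (pderiv_var (a, i) F) else 0)"
    by (intro sum.cong) (auto simp: pderiv_colored_var assms(2))
  also have "\<dots> = (\<Sum>a<m. Const (\<xi> m ^ (a * \<beta>) / of_nat m) * uncolor m (pderiv_var (a, i) F))"
    by (intro sum.cong) simp_all
  finally show ?thesis .
qed

text \<open>Shifting the colours by \<open>k\<close> multiplies the character \<open>\<xi>\<^sup>a\<^sup>\<alpha>\<close> by a root of unity. This is where the
  eigenvalue \<open>\<xi>\<^sup>-\<^sup>k\<^sup>a\<close> comes from.\<close>

lemma shifted_colored_var:
  assumes "m > 0"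
  shows "(\<Sum>\<alpha><m. Const (\<xi> m ^ (a * \<alpha>) / of_nat m) * pv ((\<alpha> + k) mod m) i) =
    Const (inverse (\<xi> m) ^ (k * a)) * colored_var m a i"
proof -
  let ?h = "\<lambda>\<beta>. Const (inverse (\<xi> m) ^ (k * a)) * (Const (\<xi> m ^ (a * \<beta>) / of_nat m) * pv \<beta> i)"
  have "Const (\<xi> m ^ (a * \<alpha>) / of_nat m) * pv ((\<alpha> + k) mod m) i = ?h ((\<alpha> + k) mod m)" for \<alpha>
  proof -
    have e: "inverse (\<xi> m) ^ (k * a) * (\<xi> m ^ (a * ((\<alpha> + k) mod m)) / of_nat m) = \<xi> m ^ (a * \<alpha>) / of_nat m"
      unfolding xi_power_mod[OF assms]
      by (simp add: distrib_left power_add power_inverse mult.commute field_simps)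
    show ?thesis by (subst e[symmetric]) (simp only: Const_mult mult.assoc)
  qed
  then have "(\<Sum>\<alpha><m. Const (\<xi> m ^ (a * \<alpha>) / of_nat m) * pv ((\<alpha> + k) mod m) i) = (\<Sum>\<alpha><m. ?h ((\<alpha> + k) mod m))"
    by simp
  also have "\<dots> = (\<Sum>\<alpha><m. ?h \<alpha>)" by (rule sum_mod_shift[OF assms])
  finally show ?thesis by (simp add: colored_var_def sum_distrib_left)
qed

lemma poly_vars_colored_var: "i \<in> I \<Longrightarrow> poly_vars (colored_var m \<alpha> i) \<subseteq> {..<m} \<times> I"
  unfolding colored_var_def by (intro poly_vars_sum poly_vars_mult) auto

lemma poly_vars_uncolor: "poly_vars F \<subseteq> {..<m} \<times> I \<Longrightarrow> poly_vars (uncolor m F) \<subseteq> {..<m} \<times> I"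
  unfolding uncolor_def by (rule poly_vars_subst) (auto dest: poly_vars_colored_var[THEN subsetD])

lemma CJ_uncolor:
  assumes m: "m > 0" and F: "poly_vars F \<subseteq> {..<m} \<times> {1..K}"
  shows "CJ m k (uncolor m F) = uncolor m
    (\<Sum>a<m. Const (inverse (\<xi> m) ^ (k * a)) * (\<Sum>i\<in>{1..K}. of_nat i * Var (a, i) * pderiv_var (a, i) F))"
proof -
  have vars: "poly_vars (uncolor m F) \<subseteq> {..<m} \<times> {1..K}" by (rule poly_vars_uncolor[OF F])
  have "CJ m k (uncolor m F) = (\<Sum>i\<in>{1..K}. if 1 \<le> i then
      (\<Sum>\<alpha><m. of_nat i * pv ((\<alpha> + k) mod m) i * pd \<alpha> i (uncolor m F)) else 0)"
    unfolding CJ_def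
  proof (rule Sum_any.expand_superset)
    show "{i. (if 1 \<le> i then (\<Sum>\<alpha><m. of_nat i * pv ((\<alpha> + k) mod m) i * pd \<alpha> i (uncolor m F)) else 0) \<noteq> 0} \<subseteq> {1..K}"
    proof (clarify, rule ccontr)
      fix i assume i: "(if 1 \<le> i then (\<Sum>\<alpha><m. of_nat i * pv ((\<alpha> + k) mod m) i * pd \<alpha> i (uncolor m F)) else 0) \<noteq> 0"
        "i \<notin> {1..K}"
      then have "pd \<alpha> i (uncolor m F) = 0" for \<alpha> using vars by (intro pderiv_var_notin) auto
      then show False using i(1) by (simp split: if_splits)
    qed
  qed simp
  also have "\<dots> = (\<Sum>i\<in>{1..K}. \<Sum>a<m. Const (inverse (\<xi> m) ^ (k * a)) *
      (of_nat i * colored_var m a i * uncolor m (pderiv_var (a, i) F)))"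
  proof (rule sum.cong[OF refl])
    fix i assume "i \<in> {1..K}"
    then have "(if 1 \<le> i then (\<Sum>\<alpha><m. of_nat i * pv ((\<alpha> + k) mod m) i * pd \<alpha> i (uncolor m F)) else 0) =
      (\<Sum>\<alpha><m. \<Sum>a<m. (of_nat i * uncolor m (pderiv_var (a, i) F)) * (Const (\<xi> m ^ (a * \<alpha>) / of_nat m) * pv ((\<alpha> + k) mod m) i))"
      by (simp add: pderiv_uncolor[OF F] sum_distrib_left mult_ac)
    also have "\<dots> = (\<Sum>a<m. (of_nat i * uncolor m (pderiv_var (a, i) F)) * (\<Sum>\<alpha><m. Const (\<xi> m ^ (a * \<alpha>) / of_nat m) * pv ((\<alpha> + k) mod m) i))"
      by (subst sum.swap) (simp only: sum_distrib_left)
    finally show "(if 1 \<le> i then (\<Sum>\<alpha><m. of_nat i * pv ((\<alpha> + k) mod m) i * pd \<alpha> i (uncolor m F)) else 0) =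
      (\<Sum>a<m. Const (inverse (\<xi> m) ^ (k * a)) * (of_nat i * colored_var m a i * uncolor m (pderiv_var (a, i) F)))"
      unfolding shifted_colored_var[OF m] by (simp only: mult_ac)
  qed
  also have "\<dots> = (\<Sum>a<m. \<Sum>i\<in>{1..K}. Const (inverse (\<xi> m) ^ (k * a)) *
      (of_nat i * colored_var m a i * uncolor m (pderiv_var (a, i) F)))"
    by (rule sum.swap)
  finally show ?thesis by (simp add: uncolor_sum uncolor_mult sum_distrib_left)
qed

lemma CJ0_eq_finite_sum:
  assumes vars: "poly_vars f \<subseteq> {..<m} \<times> {1..K}"
  shows "CJ0 m f = Const (1/2) * (\<Sum>i\<in>{1..K}. \<Sum>j\<in>{1..K}. \<Sum>\<alpha><m. \<Sum>\<gamma><m.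
        of_nat (i + j) * pv \<alpha> i * pv \<gamma> j * pd ((\<alpha> + \<gamma>) mod m) (i + j) f
      + of_nat (m * i * j) * pv ((\<alpha> + \<gamma>) mod m) (i + j) * pd \<alpha> i (pd \<gamma> j f))"
proof -
  let ?t = "\<lambda>(i, j). if 1 \<le> i \<and> 1 \<le> j then (\<Sum>\<alpha><m. \<Sum>\<gamma><m.
        of_nat (i + j) * pv \<alpha> i * pv \<gamma> j * pd ((\<alpha> + \<gamma>) mod m) (i + j) f
      + of_nat (m * i * j) * pv ((\<alpha> + \<gamma>) mod m) (i + j) * pd \<alpha> i (pd \<gamma> j f)) else 0"
  have "Sum_any ?t = sum ?t ({1..K} \<times> {1..K})"
  proof (rule Sum_any.expand_superset)
    show "{p. ?t p \<noteq> 0} \<subseteq> {1..K} \<times> {1..K}"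
    proof (rule subsetI, rule ccontr)
      fix p assume p: "p \<in> {p. ?t p \<noteq> 0}" "p \<notin> {1..K} \<times> {1..K}"
      obtain i j where [simp]: "p = (i, j)" by (cases p)
      have ij: "1 \<le> i" "1 \<le> j" using p(1) by (auto split: if_splits)
      then have K: "K < i \<or> K < j" using p(2) by auto
      then have "pd \<beta> (i + j) f = 0" for \<beta> using vars by (intro pderiv_var_notin) auto
      moreover have "pd \<alpha> i (pd \<gamma> j f) = 0" for \<alpha> \<gamma>
      proof (cases "K < i")
        case True
        then show ?thesis using poly_vars_pderiv[OF vars, of "(\<gamma>, j)"] by (intro pderiv_var_notin) auto
      next
        case False
        then have "pd \<gamma> j f = 0" using vars K by (intro pderiv_var_notin) auto
        then show ?thesis by simp
      qed
      ultimately show False using p(1) by (simp split: if_splits)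
    qed
  qed simp
  also have "\<dots> = (\<Sum>i\<in>{1..K}. \<Sum>j\<in>{1..K}. ?t (i, j))"
    by (simp only: sum.cartesian_product case_prod_eta)
  also have "\<dots> = (\<Sum>i\<in>{1..K}. \<Sum>j\<in>{1..K}. \<Sum>\<alpha><m. \<Sum>\<gamma><m.
        of_nat (i + j) * pv \<alpha> i * pv \<gamma> j * pd ((\<alpha> + \<gamma>) mod m) (i + j) f
      + of_nat (m * i * j) * pv ((\<alpha> + \<gamma>) mod m) (i + j) * pd \<alpha> i (pd \<gamma> j f))"
    by (intro sum.cong refl) (simp only: prod.case atLeastAtMost_iff if_True simp_thms)
  finally show ?thesis unfolding CJ0_def by (simp only:)
qed

text \<open>The character of the derivative, at \<open>\<alpha> + \<gamma>\<close>, factors over the two multiplied indeterminates, so both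
  sums over colours can be carried out and give \<open>P\<^sup>a\<^sub>i P\<^sup>a\<^sub>j\<close> with the same \<open>a\<close>.\<close>

lemma CJ0_join_uncolor:
  assumes m: "m > 0" and F: "poly_vars F \<subseteq> {..<m} \<times> {1..K}"
  shows "(\<Sum>\<alpha><m. \<Sum>\<gamma><m. of_nat (i + j) * pv \<alpha> i * pv \<gamma> j * pd ((\<alpha> + \<gamma>) mod m) (i + j) (uncolor m F)) =
    uncolor m (of_nat m * (\<Sum>a<m. of_nat (i + j) * Var (a, i) * Var (a, j) * pderiv_var (a, i + j) F))"
proof -
  let ?c = "\<lambda>a \<alpha>. Const (\<xi> m ^ (a * \<alpha>) / of_nat m)"
  let ?D = "\<lambda>a. uncolor m (pderiv_var (a, i + j) F)"
  have c: "?c a ((\<alpha> + \<gamma>) mod m) = of_nat m * (?c a \<alpha> * ?c a \<gamma>)" for a \<alpha> \<gamma>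
    unfolding xi_power_mod[OF m] Const_of_nat[symmetric] Const_mult[symmetric]
    using m by (simp add: distrib_left power_add)
  have "(\<Sum>\<alpha><m. \<Sum>\<gamma><m. of_nat (i + j) * pv \<alpha> i * pv \<gamma> j * pd ((\<alpha> + \<gamma>) mod m) (i + j) (uncolor m F)) =
      (\<Sum>\<alpha><m. \<Sum>\<gamma><m. of_nat (i + j) * pv \<alpha> i * pv \<gamma> j * (\<Sum>a<m. of_nat m * (?c a \<alpha> * ?c a \<gamma>) * ?D a))"
    using m by (intro sum.cong refl) (simp add: pderiv_uncolor[OF F] c)
  also have "\<dots> = (\<Sum>\<alpha><m. \<Sum>\<gamma><m. \<Sum>a<m. of_nat m * of_nat (i + j) * ?D a * ((?c a \<alpha> * pv \<alpha> i) * (?c a \<gamma> * pv \<gamma> j)))"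
    by (simp only: sum_distrib_left mult_ac)
  also have "\<dots> = (\<Sum>\<alpha><m. \<Sum>a<m. \<Sum>\<gamma><m. of_nat m * of_nat (i + j) * ?D a * ((?c a \<alpha> * pv \<alpha> i) * (?c a \<gamma> * pv \<gamma> j)))"
    by (rule sum.cong[OF refl], rule sum.swap)
  also have "\<dots> = (\<Sum>a<m. \<Sum>\<alpha><m. \<Sum>\<gamma><m. of_nat m * of_nat (i + j) * ?D a * ((?c a \<alpha> * pv \<alpha> i) * (?c a \<gamma> * pv \<gamma> j)))"
    by (rule sum.swap)
  also have "\<dots> = (\<Sum>a<m. of_nat m * of_nat (i + j) * ?D a * (colored_var m a i * colored_var m a j))"
    unfolding colored_var_def sum_product by (simp only: sum_distrib_left)
  also have "\<dots> = uncolor m (of_nat m * (\<Sum>a<m. of_nat (i + j) * Var (a, i) * Var (a, j) * pderiv_var (a, i + j) F))"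
    by (simp only: uncolor_sum uncolor_mult uncolor_of_nat uncolor_Var sum_distrib_left mult_ac)
  finally show ?thesis .
qed

text \<open>The two derivatives produce independent diagonal colours \<open>a\<close> and \<open>b\<close>. Summing over \<open>\<gamma>\<close> is a shift by
  \<open>\<alpha>\<close> and leaves \<open>P\<^sup>b\<^sub>i\<^sub>+\<^sub>j \<xi>\<^sup>-\<^sup>\<alpha>\<^sup>b\<close>; the sum over \<open>\<alpha>\<close> then forces \<open>a = b\<close> by orthogonality.\<close>

lemma CJ0_cut_uncolor:
  assumes m: "m > 0" and F: "poly_vars F \<subseteq> {..<m} \<times> {1..K}"
  shows "(\<Sum>\<alpha><m. \<Sum>\<gamma><m. of_nat (m * i * j) * pv ((\<alpha> + \<gamma>) mod m) (i + j) * pd \<alpha> i (pd \<gamma> j (uncolor m F))) =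
    uncolor m (of_nat m * (\<Sum>a<m. of_nat (i * j) * Var (a, i + j) * pderiv_var (a, i) (pderiv_var (a, j) F)))"
proof -
  let ?c = "\<lambda>a \<alpha>. Const (\<xi> m ^ (a * \<alpha>) / of_nat m)"
  let ?D = "\<lambda>a b. uncolor m (pderiv_var (a, i) (pderiv_var (b, j) F))"
  let ?n = "of_nat (m * i * j) :: (nat \<times> nat) cpoly"
  have "pd \<alpha> i (pd \<gamma> j (uncolor m F)) = (\<Sum>b<m. \<Sum>a<m. ?c b \<gamma> * (?c a \<alpha> * ?D a b))"
    if "\<alpha> < m" "\<gamma> < m" for \<alpha> \<gamma>
    using that
    by (simp add: pderiv_uncolor[OF F] pderiv.sum pderiv_var_Const_mult
        pderiv_uncolor[OF poly_vars_pderiv[OF F]] sum_distrib_left)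
  then have "(\<Sum>\<alpha><m. \<Sum>\<gamma><m. ?n * pv ((\<alpha> + \<gamma>) mod m) (i + j) * pd \<alpha> i (pd \<gamma> j (uncolor m F))) =
      (\<Sum>\<alpha><m. \<Sum>\<gamma><m. ?n * pv ((\<alpha> + \<gamma>) mod m) (i + j) * (\<Sum>b<m. \<Sum>a<m. ?c b \<gamma> * (?c a \<alpha> * ?D a b)))"
    by (intro sum.cong refl) simp
  also have "\<dots> = (\<Sum>\<alpha><m. \<Sum>\<gamma><m. \<Sum>b<m. \<Sum>a<m. ?n * ?c a \<alpha> * ?D a b * (?c b \<gamma> * pv ((\<gamma> + \<alpha>) mod m) (i + j)))"
    by (simp only: sum_distrib_left mult_ac add.commute)
  also have "\<dots> = (\<Sum>\<alpha><m. \<Sum>b<m. \<Sum>\<gamma><m. \<Sum>a<m. ?n * ?c a \<alpha> * ?D a b * (?c b \<gamma> * pv ((\<gamma> + \<alpha>) mod m) (i + j)))"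
    by (rule sum.cong[OF refl], rule sum.swap)
  also have "\<dots> = (\<Sum>\<alpha><m. \<Sum>b<m. \<Sum>a<m. \<Sum>\<gamma><m. ?n * ?c a \<alpha> * ?D a b * (?c b \<gamma> * pv ((\<gamma> + \<alpha>) mod m) (i + j)))"
    by (rule sum.cong[OF refl], rule sum.cong[OF refl], rule sum.swap)
  also have "\<dots> = (\<Sum>\<alpha><m. \<Sum>b<m. \<Sum>a<m. ?n * ?c a \<alpha> * ?D a b * (\<Sum>\<gamma><m. ?c b \<gamma> * pv ((\<gamma> + \<alpha>) mod m) (i + j)))"
    by (simp only: sum_distrib_left)
  also have "\<dots> = (\<Sum>\<alpha><m. \<Sum>b<m. \<Sum>a<m. ?n * ?D a b * colored_var m b (i + j) *
      Const (\<xi> m ^ (a * \<alpha>) * inverse (\<xi> m) ^ (b * \<alpha>) / of_nat m))"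
  proof -
    have c: "Const (\<xi> m ^ (a * \<alpha>) * inverse (\<xi> m) ^ (b * \<alpha>) / of_nat m) = ?c a \<alpha> * Const (inverse (\<xi> m) ^ (\<alpha> * b))" for a b \<alpha>
      unfolding Const_mult[symmetric] by (simp add: mult.commute)
    have shuffle: "n * u * D * (v * X) = n * D * X * (u * v)" for n u v D X :: "(nat \<times> nat) cpoly"
      by (simp only: mult_ac)
    show ?thesis unfolding shifted_colored_var[OF m] c by (intro sum.cong refl) (rule shuffle)
  qed
  also have "\<dots> = (\<Sum>b<m. \<Sum>\<alpha><m. \<Sum>a<m. ?n * ?D a b * colored_var m b (i + j) *
      Const (\<xi> m ^ (a * \<alpha>) * inverse (\<xi> m) ^ (b * \<alpha>) / of_nat m))"
    by (rule sum.swap)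
  also have "\<dots> = (\<Sum>b<m. \<Sum>a<m. \<Sum>\<alpha><m. ?n * ?D a b * colored_var m b (i + j) *
      Const (\<xi> m ^ (a * \<alpha>) * inverse (\<xi> m) ^ (b * \<alpha>) / of_nat m))"
    by (rule sum.cong[OF refl], rule sum.swap)
  also have "\<dots> = (\<Sum>b<m. \<Sum>a<m. if a = b then ?n * ?D b b * colored_var m b (i + j) else 0)"
  proof (intro sum.cong refl)
    fix a b assume ab: "b \<in> {..<m}" "a \<in> {..<m}"
    have "(\<Sum>\<alpha><m. \<xi> m ^ (a * \<alpha>) * inverse (\<xi> m) ^ (b * \<alpha>) / of_nat m) = (if a = b then 1 else 0)"
      unfolding sum_divide_distrib[symmetric] using xi_orthogonal[of a m b] ab m by simp
    then have "(\<Sum>\<alpha><m. Const (\<xi> m ^ (a * \<alpha>) * inverse (\<xi> m) ^ (b * \<alpha>) / of_nat m)) =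
        (if a = b then 1 else 0 :: (nat \<times> nat) cpoly)"
      unfolding Const_sum[symmetric] by simp
    then show "(\<Sum>\<alpha><m. ?n * ?D a b * colored_var m b (i + j) *
        Const (\<xi> m ^ (a * \<alpha>) * inverse (\<xi> m) ^ (b * \<alpha>) / of_nat m)) =
      (if a = b then ?n * ?D b b * colored_var m b (i + j) else 0)"
      unfolding sum_distrib_left[symmetric] by simp
  qed
  also have "\<dots> = (\<Sum>b<m. ?n * ?D b b * colored_var m b (i + j))" by simp
  also have "\<dots> = uncolor m (of_nat m * (\<Sum>a<m. of_nat (i * j) * Var (a, i + j) * pderiv_var (a, i) (pderiv_var (a, j) F)))"
    by (simp only: uncolor_sum uncolor_mult uncolor_of_nat uncolor_Var sum_distrib_left of_nat_mult mult_ac)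
  finally show ?thesis .
qed

lemma CJ0_uncolor:
  assumes m: "m > 0" and F: "poly_vars F \<subseteq> {..<m} \<times> {1..K}"
  shows "CJ0 m (uncolor m F) = Const (of_nat m / 2) * uncolor m (\<Sum>a<m. \<Sum>i\<in>{1..K}. \<Sum>j\<in>{1..K}.
      of_nat (i + j) * Var (a, i) * Var (a, j) * pderiv_var (a, i + j) F
    + of_nat (i * j) * Var (a, i + j) * pderiv_var (a, i) (pderiv_var (a, j) F))"
proof -
  let ?t = "\<lambda>a i j. of_nat (i + j) * Var (a, i) * Var (a, j) * pderiv_var (a, i + j) F
    + of_nat (i * j) * Var (a, i + j) * pderiv_var (a, i) (pderiv_var (a, j) F)"
  have half: "Const (1/2) * of_nat m = (Const (of_nat m / 2) :: (nat \<times> nat) cpoly)"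
    unfolding Const_of_nat[symmetric] Const_mult[symmetric] by simp
  have "CJ0 m (uncolor m F) = Const (1/2) * (\<Sum>i\<in>{1..K}. \<Sum>j\<in>{1..K}. uncolor m (of_nat m * (\<Sum>a<m. ?t a i j)))"
    unfolding CJ0_eq_finite_sum[OF poly_vars_uncolor[OF F]] sum.distrib
      CJ0_join_uncolor[OF m F] CJ0_cut_uncolor[OF m F]
    by (simp only: uncolor_add distrib_left sum.distrib)
  also have "\<dots> = Const (1/2) * of_nat m * uncolor m (\<Sum>i\<in>{1..K}. \<Sum>j\<in>{1..K}. \<Sum>a<m. ?t a i j)"
    by (simp only: uncolor_sum uncolor_mult uncolor_of_nat sum_distrib_left mult.assoc)
  also have "(\<Sum>i\<in>{1..K}. \<Sum>j\<in>{1..K}. \<Sum>a<m. ?t a i j) = (\<Sum>i\<in>{1..K}. \<Sum>a<m. \<Sum>j\<in>{1..K}. ?t a i j)"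
    by (rule sum.cong[OF refl], rule sum.swap)
  also have "\<dots> = (\<Sum>a<m. \<Sum>i\<in>{1..K}. \<Sum>j\<in>{1..K}. ?t a i j)" by (rule sum.swap)
  finally show ?thesis unfolding half .
qed

lemma cut_join_eq:
  assumes f: "poly_vars f \<subseteq> {1..K}"
  shows "cut_join K f = (\<Sum>i\<in>{1..K}. \<Sum>j\<in>{1..K}. of_nat (i + j) * Var i * Var j * pderiv_var (i + j) f
     + of_nat (i * j) * Var (i + j) * pderiv_var i (pderiv_var j f))"
proof -
  let ?g = "\<lambda>(i, j). of_nat (i + j) * Var i * Var j * pderiv_var (i + j) f"
  let ?A = "{(i, j). i \<in> {1..K} \<and> j \<in> {1..K} \<and> i + j \<le> K}"
  have "(\<Sum>k\<in>{1..K}. \<Sum>r\<in>{1..<k}. of_nat k * Var r * Var (k - r) * pderiv_var k f) =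
      (\<Sum>(k, r)\<in>Sigma {1..K} (\<lambda>k. {1..<k}). of_nat k * Var r * Var (k - r) * pderiv_var k f)"
    by (simp add: sum.Sigma)
  also have "\<dots> = sum ?g ?A"
    by (rule sum.reindex_bij_witness[of _ "\<lambda>(i, j). (i + j, i)" "\<lambda>(k, r). (r, k - r)"]) auto
  also have "\<dots> = sum ?g ({1..K} \<times> {1..K})"
  proof (rule sum.mono_neutral_left)
    show "\<forall>p\<in>{1..K} \<times> {1..K} - ?A. ?g p = 0"
    proof
      fix p assume p: "p \<in> {1..K} \<times> {1..K} - ?A"
      obtain i j where ij: "p = (i, j)" by (cases p)
      then have "pderiv_var (i + j) f = 0" using f p by (intro pderiv_var_notin) auto
      then show "?g p = 0" by (simp add: ij)
    qed
  qed auto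
  also have "\<dots> = (\<Sum>i\<in>{1..K}. \<Sum>j\<in>{1..K}. of_nat (i + j) * Var i * Var j * pderiv_var (i + j) f)"
    by (simp only: sum.cartesian_product)
  finally show ?thesis by (simp only: cut_join_def sum.distrib)
qed

section \<open>Coloured Schur polynomials\<close>

definition inject_color :: "nat \<Rightarrow> nat cpoly \<Rightarrow> (nat \<times> nat) cpoly" where
  "inject_color a = poly_subst (\<lambda>i. Var (a, i))"

lemma poly_vars_inject_color:
  "poly_vars s \<subseteq> I \<Longrightarrow> poly_vars (inject_color a s) \<subseteq> {a} \<times> I"
  unfolding inject_color_def by (rule poly_vars_subst) auto

lemma pderiv_inject_color: "pderiv_var (a, i) (inject_color a s) = inject_color a (pderiv_var i s)"
proof -
  have "pderiv_var (a, i) (inject_color a s) =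
      (\<Sum>k\<in>insert i (poly_vars s). inject_color a (pderiv_var k s) * pderiv_var (a, i) (Var (a, k)))"
    unfolding inject_color_def by (intro chain_rule pderiv.derivation_axioms) auto
  also have "\<dots> = (\<Sum>k\<in>insert i (poly_vars s). if k = i then inject_color a (pderiv_var i s) else 0)"
    by (intro sum.cong) (auto simp: pderiv_var_Var)
  finally show ?thesis by simp
qed

lemma pderiv_inject_color_mult:
  assumes "poly_vars R \<subseteq> (- {a}) \<times> UNIV"
  shows "pderiv_var (a, i) (inject_color a s * R) = inject_color a (pderiv_var i s) * R"
proof -
  have "pderiv_var (a, i) R = 0" using assms by (intro pderiv_var_notin) auto
  then show ?thesis by (simp add: pderiv_var_mult pderiv_inject_color)
qed

lemma inject_color_hom:
  "inject_color a (f + g) = inject_color a f + inject_color a g"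
  "inject_color a (f * g) = inject_color a f * inject_color a g"
  "inject_color a (sum h A) = (\<Sum>x\<in>A. inject_color a (h x))"
  "inject_color a (of_nat n) = of_nat n"
  "inject_color a (Const c) = Const c"
  "inject_color a (Var i) = Var (a, i)"
  by (simp_all add: inject_color_def poly_subst_add poly_subst_mult poly_subst_sum poly_subst.hom_of_nat)

lemma colored_schur_eq: "colored_schur m lam = uncolor m (\<Prod>\<alpha><m. inject_color \<alpha> (schur (lam \<alpha>)))"
  unfolding colored_schur_def uncolor_def inject_color_def
  by (simp add: poly_subst.hom_prod poly_subst_subst)

text \<open>Inverting the Fourier transform over the colours separates the alphabets again. The inverse is
  composed with a bijection between pairs and numbers because polynomials in indeterminates of
  type \<^typ>\<open>nat\<close> form an integral domain by the linear order on \<^typ>\<open>nat\<close>.\<close>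

lemma colored_schur_nonzero:
  assumes "\<And>\<alpha>. \<alpha> < m \<Longrightarrow> is_partition (lam \<alpha>)"
  shows "colored_schur m lam \<noteq> 0"
proof
  assume 0: "colored_schur m lam = 0"
  define \<psi> :: "(nat \<times> nat) cpoly \<Rightarrow> nat cpoly"
    where "\<psi> = poly_subst (\<lambda>(\<beta>, i). \<Sum>c<m. Const (inverse (\<xi> m) ^ (c * \<beta>)) * Var (prod_encode (c, i)))"
  have inv: "\<psi> (colored_var m a i) = Var (prod_encode (a, i))" if a: "a < m" for a i
  proof -
    have "\<psi> (colored_var m a i) = (\<Sum>\<beta><m. \<Sum>c<m. Const (\<xi> m ^ (a * \<beta>) * inverse (\<xi> m) ^ (c * \<beta>) / of_nat m) * Var (prod_encode (c, i)))"
      unfolding \<psi>_def colored_var_def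
      by (simp add: poly_subst_sum poly_subst_mult sum_distrib_left flip: Const_mult mult.assoc)
    also have "\<dots> = (\<Sum>c<m. \<Sum>\<beta><m. Const (\<xi> m ^ (a * \<beta>) * inverse (\<xi> m) ^ (c * \<beta>) / of_nat m) * Var (prod_encode (c, i)))"
      by (rule sum.swap)
    also have "\<dots> = (\<Sum>c<m. Const ((\<Sum>\<beta><m. \<xi> m ^ (a * \<beta>) * inverse (\<xi> m) ^ (c * \<beta>)) / of_nat m) * Var (prod_encode (c, i)))"
      by (simp only: Const_sum sum_distrib_right sum_divide_distrib)
    also have "\<dots> = (\<Sum>c<m. if c = a then Var (prod_encode (a, i)) else 0)"
      using a by (intro sum.cong refl) (auto simp: xi_orthogonal)
    finally show ?thesis using a by simp
  qed
  have "\<psi> (colored_schur m lam) = (\<Prod>\<alpha><m. poly_subst (\<lambda>i. Var (prod_encode (\<alpha>, i))) (schur (lam \<alpha>)))"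
  proof -
    have "\<psi> (colored_schur m lam) = (\<Prod>\<alpha><m. poly_subst (\<lambda>i. \<psi> (colored_var m \<alpha> i)) (schur (lam \<alpha>)))"
      by (simp add: \<psi>_def colored_schur_def poly_subst.hom_prod poly_subst_subst)
    then show ?thesis by (simp add: inv)
  qed
  then have "(\<Prod>\<alpha><m. poly_subst (\<lambda>i. Var (prod_encode (\<alpha>, i))) (schur (lam \<alpha>))) = (0 :: nat cpoly)"
    using 0 by (simp add: \<psi>_def)
  then obtain \<alpha> where \<alpha>: "\<alpha> < m" "poly_subst (\<lambda>i. Var (prod_encode (\<alpha>, i))) (schur (lam \<alpha>)) = (0 :: nat cpoly)"
    by auto
  have "schur (lam \<alpha>) = poly_subst (\<lambda>n. Var (snd (prod_decode n))) (poly_subst (\<lambda>i. Var (prod_encode (\<alpha>, i))) (schur (lam \<alpha>)))"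
    by (simp add: poly_subst_subst poly_subst_Var_id)
  then show False using \<alpha> schur_nonzero[OF assms] by simp
qed

theorem theorem3p7:
  fixes m :: nat and lam :: "nat \<Rightarrow> nat \<Rightarrow> nat"
  assumes "m \<ge> 1"
    and "\<And>\<alpha>. \<alpha> < m \<Longrightarrow> is_partition (lam \<alpha>)"
  shows "is_eigenvector m (CJ0 m) (colored_schur m lam) (eigval0 m lam) \<and>
    (\<forall>k\<in>{1..m - 1}. is_eigenvector m (CJ m k) (colored_schur m lam) (eigval m k lam))"
proof -
  note part = assms(2)
  have m: "m > 0" using assms(1) by simp
  obtain len where len: "\<And>\<alpha> i. \<alpha> < m \<Longrightarrow> i > len \<alpha> \<Longrightarrow> lam \<alpha> i = 0"
    using part unfolding is_partition_def by metis
  define n where "n = (\<Sum>\<alpha><m. len \<alpha>)"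
  have n: "lam \<alpha> i = 0" if "\<alpha> < m" "i > n" for \<alpha> i
    using that len[of \<alpha> i] member_le_sum[of \<alpha> "{..<m}" len] by (auto simp: n_def)
  have "\<exists>K. poly_vars (schur (lam \<alpha>)) \<subseteq> {1..K}" if "\<alpha> < m" for \<alpha>
    using finite_vars_bound[OF poly_vars_schur[OF part[OF that]], of 0] by metis
  then obtain bd where bd: "\<And>\<alpha>. \<alpha> < m \<Longrightarrow> poly_vars (schur (lam \<alpha>)) \<subseteq> {1..bd \<alpha>}" by metis
  define K where "K = (\<Sum>\<alpha><m. bd \<alpha>)"
  have K: "poly_vars (schur (lam \<alpha>)) \<subseteq> {1..K}" if "\<alpha> < m" for \<alpha>
    using that bd[of \<alpha>] member_le_sum[of \<alpha> "{..<m}" bd] by (fastforce simp: K_def)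

  \<comment> \<open>\<open>G\<close> is the coloured Schur polynomial in the diagonal alphabets, \<open>R a\<close> the part of it that the
    operators in alphabet \<open>a\<close> treat as a constant.\<close>
  define G where "G = (\<Prod>\<alpha><m. inject_color \<alpha> (schur (lam \<alpha>)))"
  define R where "R = (\<lambda>a. \<Prod>\<alpha>\<in>{..<m} - {a}. inject_color \<alpha> (schur (lam \<alpha>)))"
  have f: "colored_schur m lam = uncolor m G" by (simp add: colored_schur_eq G_def)
  have GR: "G = inject_color a (schur (lam a)) * R a" if "a < m" for a
    unfolding G_def R_def using that by (subst prod.remove[of _ a]) auto
  have G: "poly_vars G \<subseteq> {..<m} \<times> {1..K}"
    unfolding G_def
  proof (rule poly_vars_prod)
    fix \<alpha> assume "\<alpha> \<in> {..<m}"
    then show "poly_vars (inject_color \<alpha> (schur (lam \<alpha>))) \<subseteq> {..<m} \<times> {1..K}"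
      using poly_vars_inject_color[OF K, of \<alpha> \<alpha>] by auto
  qed
  have R: "poly_vars (R a) \<subseteq> (- {a}) \<times> UNIV" for a
    unfolding R_def
  proof (rule poly_vars_prod)
    fix \<alpha> assume "\<alpha> \<in> {..<m} - {a}"
    then show "poly_vars (inject_color \<alpha> (schur (lam \<alpha>))) \<subseteq> (- {a}) \<times> UNIV"
      using poly_vars_inject_color[of "schur (lam \<alpha>)" UNIV \<alpha>] by auto
  qed
  note pd = pderiv_inject_color_mult[OF R]

  have colored: "colored_schur m lam \<in> colored_polys m"
    using poly_vars_uncolor[OF G] unfolding f colored_polys_def by auto
  have nonzero: "colored_schur m lam \<noteq> 0" by (rule colored_schur_nonzero[OF part])

  have CJ: "CJ m k (colored_schur m lam) = Const (eigval m k lam) * colored_schur m lam" for k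
  proof -
    let ?size = "\<lambda>a. \<Sum>i=1..n. of_nat (lam a i) :: complex"
    have "(\<Sum>i\<in>{1..K}. of_nat i * Var (a, i) * pderiv_var (a, i) G) = Const (?size a) * G" if a: "a < m" for a
    proof -
      have "(\<Sum>i\<in>{1..K}. of_nat i * Var (a, i) * pderiv_var (a, i) G) =
          inject_color a (euler K (schur (lam a))) * R a"
        unfolding GR[OF a] pd euler_def inject_color_hom sum_distrib_right by (simp only: mult.assoc)
      also have "euler K (schur (lam a)) = Const (?size a) * schur (lam a)"
        using part[OF a] n[OF a] K[OF a] by (rule euler_schur)
      finally show ?thesis unfolding GR[OF a] inject_color_hom by (simp only: mult.assoc)
    qed
    then have "CJ m k (uncolor m G) = uncolor m (\<Sum>a<m. Const (inverse (\<xi> m) ^ (k * a) * ?size a) * G)"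
      unfolding CJ_uncolor[OF m G] by (intro arg_cong[of _ _ "uncolor m"] sum.cong refl) (simp add: Const_mult)
    also have "\<dots> = Const (\<Sum>a<m. inverse (\<xi> m) ^ (k * a) * ?size a) * uncolor m G"
      by (simp add: uncolor_sum uncolor_mult Const_sum sum_distrib_right)
    also have "(\<Sum>a<m. inverse (\<xi> m) ^ (k * a) * ?size a) = eigval m k lam"
    proof -
      have "eigval m k lam = (\<Sum>i\<in>{1..n}. if 1 \<le> i then \<Sum>\<alpha><m. inverse (\<xi> m) ^ (k * \<alpha>) * of_nat (lam \<alpha> i) else 0)"
        unfolding eigval_def
      proof (rule Sum_any.expand_superset)
        show "{i. (if 1 \<le> i then \<Sum>\<alpha><m. inverse (\<xi> m) ^ (k * \<alpha>) * of_nat (lam \<alpha> i) else 0) \<noteq> 0} \<subseteq> {1..n}"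
          using n by (force split: if_splits intro!: sum.neutral)
      qed simp
      also have "\<dots> = (\<Sum>i=1..n. \<Sum>\<alpha><m. inverse (\<xi> m) ^ (k * \<alpha>) * of_nat (lam \<alpha> i))"
        by (intro sum.cong) auto
      also have "\<dots> = (\<Sum>\<alpha><m. \<Sum>i=1..n. inverse (\<xi> m) ^ (k * \<alpha>) * of_nat (lam \<alpha> i))"
        by (rule sum.swap)
      finally show ?thesis by (simp only: sum_distrib_left)
    qed
    finally show ?thesis unfolding f .
  qed

  have CJ0: "CJ0 m (colored_schur m lam) = Const (eigval0 m lam) * colored_schur m lam"
  proof -
    let ?e = "\<lambda>a i. of_nat (lam a i) * (of_nat (lam a i) - 2 * of_nat i + 1) :: complex"
    have "(\<Sum>i\<in>{1..K}. \<Sum>j\<in>{1..K}. of_nat (i + j) * Var (a, i) * Var (a, j) * pderiv_var (a, i + j) G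
        + of_nat (i * j) * Var (a, i + j) * pderiv_var (a, i) (pderiv_var (a, j) G)) = Const (\<Sum>i=1..n. ?e a i) * G"
      if a: "a < m" for a
    proof -
      have "(\<Sum>i\<in>{1..K}. \<Sum>j\<in>{1..K}. of_nat (i + j) * Var (a, i) * Var (a, j) * pderiv_var (a, i + j) G
        + of_nat (i * j) * Var (a, i + j) * pderiv_var (a, i) (pderiv_var (a, j) G)) =
          inject_color a (cut_join K (schur (lam a))) * R a"
        unfolding GR[OF a] pd cut_join_eq[OF K[OF a]] inject_color_hom sum_distrib_right distrib_right
        by (simp only: mult.assoc)
      also have "cut_join K (schur (lam a)) = Const (\<Sum>i=1..n. ?e a i) * schur (lam a)"
        using part[OF a] n[OF a] K[OF a] by (rule cut_join_schur)
      finally show ?thesis unfolding GR[OF a] inject_color_hom by (simp only: mult.assoc)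
    qed
    then have "CJ0 m (uncolor m G) = Const (of_nat m / 2) * uncolor m (\<Sum>a<m. Const (\<Sum>i=1..n. ?e a i) * G)"
      unfolding CJ0_uncolor[OF m G]
      by (intro arg_cong[of _ _ "\<lambda>x. Const (of_nat m / 2) * uncolor m x"] sum.cong refl) (simp only: lessThan_iff)
    also have "\<dots> = Const (of_nat m / 2 * (\<Sum>a<m. \<Sum>i=1..n. ?e a i)) * uncolor m G"
      by (simp only: uncolor_sum uncolor_mult uncolor_Const Const_mult Const_sum[of _ "{..<m}"] sum_distrib_right mult.assoc)
    also have "of_nat m / 2 * (\<Sum>a<m. \<Sum>i=1..n. ?e a i) = eigval0 m lam"
    proof -
      have "Sum_any (\<lambda>i. if 1 \<le> i then \<Sum>\<alpha><m. ?e \<alpha> i else 0) = (\<Sum>i\<in>{1..n}. if 1 \<le> i then \<Sum>\<alpha><m. ?e \<alpha> i else 0)"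
      proof (rule Sum_any.expand_superset)
        show "{i. (if 1 \<le> i then \<Sum>\<alpha><m. ?e \<alpha> i else 0) \<noteq> 0} \<subseteq> {1..n}"
          using n by (force split: if_splits intro!: sum.neutral)
      qed simp
      also have "\<dots> = (\<Sum>i=1..n. \<Sum>\<alpha><m. ?e \<alpha> i)"
        by (intro sum.cong) auto
      also have "\<dots> = (\<Sum>\<alpha><m. \<Sum>i=1..n. ?e \<alpha> i)"
        by (rule sum.swap)
      finally show ?thesis unfolding eigval0_def by (simp only:)
    qed
    finally show ?thesis unfolding f .
  qed

  show ?thesis
    using colored nonzero CJ0 CJ by (simp add: is_eigenvector_def)
qed

end
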